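(* Consider on $\mathbb{S}^1\times\mathbb{R}^2$ the ODE $$\dot X=\sin(X)U-\cos(X)V,\qquad \dot U=\cos X,\qquad \dot V=\sin X.$$ Then $\mathbb{S}^1\times\mathbb{R}^2=\bigcup_{c\ge1/2,\ \alpha\in\{+,-\}}\mathbb{T}^\alpha_c\cup\mathbb{T}_\infty$ and each of the sets $\mathbb{T}^\alpha_c$, $\mathbb{T}_\infty$ is invariant under the flow. More precisely: (i) for $\alpha\in\{+,-\}$, $\mathbb{T}^\alpha_{1/2}$ consists of a single periodic orbit of period $2\pi$; (ii) for $c>1/2$ and $\alpha\in\{+,-\}$, the orbits in $\mathbb{T}^\alpha_c$ are either all periodic or all dense in $\mathbb{T}^\alpha_c$; moreover the set of $c>1/2$ for which the orbits in $\mathbb{T}^\alpha_c$ are periodic is countable and dense in $(1/2,\infty)$; (iii) on $\mathbb{T}_\infty$, the solution with initial condition $(x_0,u_0,v_0)$ is $(X_t,U_t,V_t)=(x_0,\,u_0+t\cos x_0,\,v_0+t\sin x_0)$.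
   Context: $\mathbb{S}^1=\mathbb{R}/2\pi\mathbb{Z}$. For $x\in\mathbb{S}^1$, $\mathcal R_x$ is the rotation of $\mathbb{R}^2$ of angle $x$, and $\mathcal R(x,z)=(x,\mathcal R_xz)$. $H:\mathbb{R}^2\to(0,\infty]$, $H(u,v)=\frac12(u^2+v^2-\log(v^2))$ if $v\ne0$, $H(u,v)=\infty$ if $v=0$; its minimum value $1/2$ is attained at $(0,\pm1)$. For $c\in[1/2,\infty)$, $H^+_c=H^{-1}(c)\cap\{v>0\}$, $H^-_c=H^{-1}(c)\cap\{v<0\}$; $H_\infty=\{v=0\}$. $\mathbb{T}^\alpha_c=\mathcal R(\mathbb{S}^1\times H^\alpha_c)$ and $\mathbb{T}_\infty=\mathcal R(\mathbb{S}^1\times H_\infty)$. *)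

theory Defs
  imports "HOL-Analysis.Analysis"
begin

text \<open>Points of S^1 x R^2 are represented by lifts (x,u,v) in R x R^2;
  the angle x is taken modulo 2 pi via the relation modeq.\<close>

datatype sign = Plus | Minus

definition modeq :: "real \<times> real \<times> real \<Rightarrow> real \<times> real \<times> real \<Rightarrow> bool" where
  "modeq p q \<longleftrightarrow> (\<exists>k::int. fst p - fst q = 2 * pi * of_int k) \<and> snd p = snd q"

definition F :: "real \<times> real \<times> real \<Rightarrow> real \<times> real \<times> real" where
  "F p = (case p of (x, u, v) \<Rightarrow> (sin x * u - cos x * v, cos x, sin x))"

definition is_sol :: "(real \<Rightarrow> real \<times> real \<times> real) \<Rightarrow> bool" where
  "is_sol \<gamma> \<longleftrightarrow> (\<forall>t. (\<gamma> has_vector_derivative F (\<gamma> t)) (at t))"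

definition rot :: "real \<Rightarrow> real \<times> real \<Rightarrow> real \<times> real" where
  "rot x z = (case z of (u, v) \<Rightarrow> (cos x * u - sin x * v, sin x * u + cos x * v))"

definition H :: "real \<times> real \<Rightarrow> ereal" where
  "H z = (case z of (u, v) \<Rightarrow>
     (if v = 0 then \<infinity> else ereal ((u\<^sup>2 + v\<^sup>2 - ln (v\<^sup>2)) / 2)))"

fun Hset :: "sign \<Rightarrow> real \<Rightarrow> (real \<times> real) set" where
  "Hset Plus c = {z. H z = ereal c \<and> snd z > 0}"
| "Hset Minus c = {z. H z = ereal c \<and> snd z < 0}"

definition Hinf :: "(real \<times> real) set" where
  "Hinf = {z. snd z = 0}"

definition Tset :: "sign \<Rightarrow> real \<Rightarrow> (real \<times> real \<times> real) set" where
  "Tset \<alpha> c = {(x, rot x z) | x z. z \<in> Hset \<alpha> c}"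

definition Tinf :: "(real \<times> real \<times> real) set" where
  "Tinf = {(x, rot x z) | x z. z \<in> Hinf}"

text \<open>Orbit of a solution, viewed in S^1 x R^2 and pulled back to the lift
  (saturated under x |-> x + 2 pi k).\<close>
definition orbit :: "(real \<Rightarrow> real \<times> real \<times> real) \<Rightarrow> (real \<times> real \<times> real) set" where
  "orbit \<gamma> = {q. \<exists>t. modeq (\<gamma> t) q}"

definition periodic_sol :: "(real \<Rightarrow> real \<times> real \<times> real) \<Rightarrow> bool" where
  "periodic_sol \<gamma> \<longleftrightarrow> (\<exists>P>0. \<forall>t. modeq (\<gamma> (t + P)) (\<gamma> t))"

definition invariant :: "(real \<times> real \<times> real) set \<Rightarrow> bool" where
  "invariant S \<longleftrightarrow> (\<forall>\<gamma>. is_sol \<gamma> \<longrightarrow> \<gamma> 0 \<in> S \<longrightarrow> (\<forall>t. \<gamma> t \<in> S))"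

definition all_periodic :: "sign \<Rightarrow> real \<Rightarrow> bool" where
  "all_periodic \<alpha> c \<longleftrightarrow> (\<forall>\<gamma>. is_sol \<gamma> \<longrightarrow> \<gamma> 0 \<in> Tset \<alpha> c \<longrightarrow> periodic_sol \<gamma>)"

definition all_dense :: "sign \<Rightarrow> real \<Rightarrow> bool" where
  "all_dense \<alpha> c \<longleftrightarrow> (\<forall>\<gamma>. is_sol \<gamma> \<longrightarrow> \<gamma> 0 \<in> Tset \<alpha> c \<longrightarrow> Tset \<alpha> c \<subseteq> closure (orbit \<gamma>))"

end

theory Submission
  imports Defs "HOL-Complex_Analysis.Complex_Analysis"
begin

text \<open>In the rotating frame \<open>(u, v) = rot (- X) (U, V)\<close> the system reads \<open>u' = 1 - v\<^sup>2\<close>,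
  \<open>v' = u v\<close>, \<open>X' = - v\<close>, and \<open>H\<close> is a first integral with closed level curves.
  After one turn around a level curve in \<open>v > 0\<close>, \<open>X\<close> has changed by minus the turning angle \<open>T\<close>, so
  solutions on that level are periodic if \<open>T / (2 pi)\<close> is rational and dense otherwise.
  Parametrising the levels by the ratio \<open>exp m\<close> of the largest to the smallest value of \<open>v\<^sup>2\<close>
  turns \<open>T\<close> into an integral over a fixed interval which extends holomorphically in \<open>m\<close> to a strip
  around the real axis. Its second derivative at \<open>0\<close> is negative, hence it is not constant. Therefore each
  value of \<open>T\<close> is attained at countably many levels only, and by the intermediate value theorem \<open>T / (2 pi)\<close> is
  rational on a dense set of levels.\<close>

section \<open>The turning angle\<close>

text \<open>Written over \<open>v\<close>, the turning angle has an integrand with square-root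
  singularities at the two points where \<open>u = 0\<close>, and both points move with the level.
  In the variable \<open>t = (sin f)\<^sup>2\<close> they become \<open>t = 0\<close> and
  \<open>t = 1\<close>, the zero \<open>sin f cos f\<close> of \<open>u\<close> cancels against
  \<open>dt\<close>, and what remains is smooth even at \<open>m = 0\<close>. That value is the
  limit \<open>c = 1/2\<close>, where the level shrinks to an equilibrium of the rotating frame; it
  lies outside the range in question, but there the derivatives can be computed by hand. Replacing
  \<open>m\<close> by \<open>- m\<close> exchanges \<open>t\<close> and \<open>1 - t\<close>, so the
  turning angle is even in \<open>m\<close> and its first derivative at \<open>0\<close> vanishes:
  this is why the second one is examined. Holomorphy turns global non-constancy into non-constancy
  on every interval of levels. The passage from \<open>m\<close> to \<open>c\<close> rests on
  \<open>energy\<close> being continuous and reaching every \<open>c > 1/2\<close>: countable sets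
  have countable images and density is carried over by continuity.\<close>

text \<open>Integral form of the Taylor remainder \<open>(exp z - 1 - z) / z^2\<close> and, for
  larger \<open>k\<close>, of its \<open>k\<close>-th derivative. It has no singularity at
  \<open>0\<close>, serves real and complex arguments alike, and makes positivity visible.\<close>

definition phi :: "nat \<Rightarrow> 'a::{real_normed_field,banach} \<Rightarrow> 'a" where
  "phi k z = integral {0..1} (\<lambda>s. of_real ((1 - s) * s ^ k) * exp (of_real s * z))"

lemma has_field_derivative_phi: "(phi k has_field_derivative phi (Suc k) z) (at z)"
proof -
  have "((\<lambda>z::'a. integral (cbox 0 1) (\<lambda>s. of_real ((1 - s) * s ^ k) * exp (of_real s * z)))
      has_field_derivative integral (cbox 0 1) (\<lambda>s. of_real ((1 - s) * s ^ Suc k) * exp (of_real s * z)))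
      (at z within UNIV)"
  proof (rule leibniz_rule_field_derivative
      [where fx = "\<lambda>z s. of_real ((1 - s) * s ^ Suc k) * exp (of_real s * z)"])
    fix x :: 'a and t :: real
    show "((\<lambda>x. of_real ((1 - t) * t ^ k) * exp (of_real t * x)) has_field_derivative
        of_real ((1 - t) * t ^ Suc k) * exp (of_real t * x)) (at x within UNIV)"
      by (auto intro!: derivative_eq_intros)
  next
    fix x :: 'a
    show "(\<lambda>s. of_real ((1 - s) * s ^ k) * exp (of_real s * x)) integrable_on cbox 0 1"
      by (intro integrable_continuous continuous_intros)
  next
    show "continuous_on (UNIV \<times> cbox 0 1)
        (\<lambda>(x::'a, s). of_real ((1 - s) * s ^ Suc k) * exp (of_real s * x))"
      unfolding split_beta by (intro continuous_intros)
  qed auto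
  then show ?thesis unfolding phi_def by simp
qed

lemma continuous_on_phi [continuous_intros]:
  assumes "continuous_on S f" shows "continuous_on S (\<lambda>x. phi k (f x))"
proof -
  have "continuous_on UNIV (phi k :: 'b \<Rightarrow> 'b)"
    using has_field_derivative_phi DERIV_isCont continuous_at_imp_continuous_on by blast
  then show ?thesis using continuous_on_compose2[OF _ assms] by blast
qed

lemmas phi_DERIV_chain [derivative_intros] = DERIV_chain2[OF has_field_derivative_phi]

lemma phi_of_real: "phi k (of_real x :: complex) = of_real (phi k x)"
proof -
  have "((\<lambda>s. (1 - s) * s ^ k * exp (s * x)) has_integral phi k x) {0..1}"
    unfolding phi_def of_real_eq_id id_apply
    by (intro integrable_integral integrable_continuous_real continuous_intros)
  then have "((\<lambda>s. complex_of_real ((1 - s) * s ^ k * exp (s * x))) has_integral of_real (phi k x)) {0..1}"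
    by (rule has_integral_of_real)
  then have "((\<lambda>s. of_real ((1 - s) * s ^ k) * exp (of_real s * complex_of_real x))
      has_integral of_real (phi k x)) {0..1}"
    by (simp add: exp_of_real[symmetric])
  then show ?thesis unfolding phi_def[where 'a = complex] by (rule integral_unique)
qed

lemma phi_0_eq: "x\<^sup>2 * phi 0 x = exp x - 1 - x" for x :: real
proof -
  \<comment> \<open>The antiderivative in \<open>s\<close> is
    \<open>(x * (1 - s) + 1) * exp (s * x)\<close>.\<close>
  have "((\<lambda>s. x\<^sup>2 * ((1 - s) * exp (s * x))) has_integral
      ((x * (1 - 1) + 1) * exp (1 * x) - (x * (1 - 0) + 1) * exp (0 * x))) {0..1}"
    by (intro fundamental_theorem_of_calculus)
      (auto simp: has_real_derivative_iff_has_vector_derivative[symmetric] power2_eq_square algebra_simps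
        intro!: derivative_eq_intros)
  from integral_unique[OF this] show ?thesis unfolding phi_def by simp
qed

text \<open>At \<open>0\<close> the exponential drops out and a Beta integral
  \<open>1 / ((k + 1) (k + 2))\<close> remains.\<close>

lemma phi_at_0: "phi 0 (0::complex) = 1/2" "phi 1 (0::complex) = 1/6" "phi 2 (0::complex) = 1/12"
proof -
  have *: "phi k (0::real) = 1 / (Suc k) - 1 / (k + 2)" for k
  proof -
    have "((\<lambda>s. s ^ Suc k / Suc k - s ^ Suc (Suc k) / Suc (Suc k)) has_vector_derivative (1 - s) * s ^ k)
        (at s within {0..1})" for s :: real
    proof -
      have "((\<lambda>s. s ^ Suc k / Suc k - s ^ Suc (Suc k) / Suc (Suc k)) has_real_derivative
          real (Suc k) * s ^ (Suc k - Suc 0) / Suc k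
            - real (Suc (Suc k)) * s ^ (Suc (Suc k) - Suc 0) / Suc (Suc k)) (at s within {0..1})"
        by (intro DERIV_diff DERIV_cdivide DERIV_pow)
      then show ?thesis
        by (simp add: has_real_derivative_iff_has_vector_derivative left_diff_distrib
            del: of_nat_Suc power_Suc) (simp add: algebra_simps)
    qed
    then have "((\<lambda>s. (1 - s) * s ^ k) has_integral
       ((1 ^ Suc k / Suc k - 1 ^ Suc (Suc k) / Suc (Suc k))
         - (0 ^ Suc k / Suc k - 0 ^ Suc (Suc k) / Suc (Suc k)))) {0..1::real}"
      by (intro fundamental_theorem_of_calculus) auto
    then show ?thesis unfolding phi_def by (simp add: integral_unique)
  qed
  show "phi 0 (0::complex) = 1/2" "phi 1 (0::complex) = 1/6" "phi 2 (0::complex) = 1/12"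
    using phi_of_real[of 0 0] phi_of_real[of 1 0] phi_of_real[of 2 0] by (simp_all add: * complex_eq_iff)
qed

text \<open>The real part of the integrand is \<open>(1 - s) exp (s Re z) cos (s Im z)\<close>, and
  the cosine stays positive since \<open>s Im z\<close> is below \<open>pi / 2\<close> in absolute
  value. Strictness: a continuous nonnegative function with integral \<open>0\<close> vanishes
  everywhere, but this one is \<open>1\<close> at \<open>s = 0\<close>.\<close>

lemma Re_phi_pos:
  assumes "\<bar>Im z\<bar> < pi / 2" shows "Re (phi 0 z) > 0"
proof -
  let ?f = "\<lambda>s. of_real ((1 - s) * s ^ 0) * exp (of_real s * z) :: complex"
  have "(?f has_integral phi 0 z) {0..1}"
    unfolding phi_def by (intro integrable_integral integrable_continuous_real continuous_intros)
  then have "((Re \<circ> ?f) has_integral Re (phi 0 z)) {0..1}"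
    by (rule has_integral_linear) (rule bounded_linear_Re)
  then have eq: "((\<lambda>s. (1 - s) * (exp (s * Re z) * cos (s * Im z))) has_integral Re (phi 0 z)) {0..1}"
    by (simp add: o_def Re_exp)
  have cos: "cos (s * Im z) > 0" if "s \<in> {0..1}" for s
  proof (rule cos_gt_zero_pi)
    have "\<bar>s * Im z\<bar> \<le> \<bar>Im z\<bar>" using that by (simp add: abs_mult mult_left_le_one_le)
    with assms show "- (pi / 2) < s * Im z" "s * Im z < pi / 2" by linarith+
  qed
  have "0 < integral {0..1} (\<lambda>s. (1 - s) * (exp (s * Re z) * cos (s * Im z)))"
  proof (rule ccontr)
    assume "\<not> ?thesis"
    moreover have "0 \<le> integral {0..1} (\<lambda>s. (1 - s) * (exp (s * Re z) * cos (s * Im z)))"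
      by (intro integral_nonneg has_integral_integrable[OF eq]) (auto intro!: mult_nonneg_nonneg less_imp_le[OF cos])
    ultimately have "((\<lambda>s. (1 - s) * (exp (s * Re z) * cos (s * Im z))) has_integral 0) (cbox 0 1)"
      using eq by (simp add: integral_unique)
    then have "(1 - 0) * (exp (0 * Re z) * cos (0 * Im z)) = 0"
      by (rule has_integral_0_cbox_imp_0[rotated 2])
        (auto intro!: mult_nonneg_nonneg less_imp_le[OF cos] continuous_intros)
    then show False by simp
  qed
  then show ?thesis using eq by (simp add: integral_unique)
qed

text \<open>The level of energy \<open>c\<close> is parametrised by an angle \<open>f\<close> with
  \<open>v\<^sup>2 = L exp (- m t)\<close>, \<open>t = (sin f)\<^sup>2\<close>, \<open>L = max v\<^sup>2 = m / (1 - exp (- m))\<close>. Then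
  \<open>u\<^sup>2 = 2 c - v\<^sup>2 + ln (v\<^sup>2) = v\<^sup>2 (exp (m t) (1 - (1 - exp (- m)) t) - 1)\<close>, and \<open>Jk 0 m t\<close> is this
  last bracket divided by \<open>m\<^sup>2 t (1 - t)\<close>, written without removable singularities;
  \<open>Jk k\<close> is its \<open>k\<close>-th derivative in \<open>m\<close>.\<close>
definition Jk :: "nat \<Rightarrow> 'a::{real_normed_field,banach} \<Rightarrow> real \<Rightarrow> 'a" where
  "Jk k z t = of_real (t ^ Suc k) * phi k (of_real t * z)
    + of_real ((1 - t) * (t - 1) ^ k) * phi k (of_real (t - 1) * z)"

lemma Jk_DERIV: "((\<lambda>z. Jk k z t) has_field_derivative Jk (Suc k) z t) (at z)"
  unfolding Jk_def by (auto intro!: derivative_eq_intros simp: algebra_simps)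

lemma continuous_on_Jk [continuous_intros]:
  assumes "continuous_on S f" "continuous_on S g"
  shows "continuous_on S (\<lambda>x. Jk k (f x) (g x))"
  unfolding Jk_def by (intro continuous_intros assms)

lemma Jk_of_real: "Jk k (of_real x :: complex) t = of_real (Jk k x t)"
  unfolding Jk_def of_real_mult[symmetric] phi_of_real by simp

lemma Re_Jk_pos:
  assumes "\<bar>Im z\<bar> < pi / 2" "t \<in> {0..1}" shows "Re (Jk 0 z t) > 0"
proof -
  have *: "\<bar>s * Im z\<bar> < pi / 2" if "\<bar>s\<bar> \<le> 1" for s
  proof -
    have "\<bar>s * Im z\<bar> \<le> \<bar>Im z\<bar>" using that by (simp add: abs_mult mult_left_le_one_le)
    with assms show ?thesis by linarith
  qed
  have "0 < Re (phi 0 (of_real t * z))" "0 < Re (phi 0 (of_real (t - 1) * z))"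
    using assms(2) *[of t] *[of "t - 1"] by (auto intro!: Re_phi_pos)
  moreover have "Re (Jk 0 z t) = t * Re (phi 0 (of_real t * z)) + (1 - t) * Re (phi 0 (of_real (t - 1) * z))"
    by (simp add: Jk_def)
  moreover have "0 < t * a + (1 - t) * b" if "0 < a" "0 < b" for a b
    using that assms(2) by (cases "t = 0") (auto intro!: add_pos_nonneg)
  ultimately show ?thesis by simp
qed

lemma Jk_pos: "t \<in> {0..1} \<Longrightarrow> Jk 0 x t > 0" for x :: real
  using Re_Jk_pos[of "of_real x" t] by (simp add: Jk_of_real)

text \<open>The weights \<open>t\<close> and \<open>1 - t\<close> in \<open>Jk 0\<close> are chosen
  so that the factor \<open>m^2 t (1 - t)\<close> completes the squares \<open>(t m)^2\<close> and
  \<open>((t - 1) m)^2\<close> demanded by \<open>phi_0_eq\<close>; the linear Taylor terms then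
  cancel.\<close>

lemma Jk_eq:
  "m\<^sup>2 * (t * (1 - t)) * Jk 0 m t = exp (m * t) * (1 - (1 - exp (- m)) * t) - 1" for m :: real
proof -
  have a: "(t * m)\<^sup>2 * phi 0 (t * m) = exp (t * m) - 1 - t * m" by (rule phi_0_eq)
  have b: "((t - 1) * m)\<^sup>2 * phi 0 ((t - 1) * m) = exp ((t - 1) * m) - 1 - (t - 1) * m" by (rule phi_0_eq)
  have "m\<^sup>2 * (t * (1 - t)) * Jk 0 m t
      = (1 - t) * ((t * m)\<^sup>2 * phi 0 (t * m)) + t * (((t - 1) * m)\<^sup>2 * phi 0 ((t - 1) * m))"
    unfolding Jk_def by (simp add: algebra_simps power2_eq_square)
  also have "\<dots> = (1 - t) * (exp (m * t) - 1 - t * m) + t * (exp (m * t) * exp (- m) - 1 - (t - 1) * m)"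
    unfolding a b exp_add[symmetric] by (simp add: algebra_simps)
  also have "\<dots> = exp (m * t) * (1 - (1 - exp (- m)) * t) - 1"
    by (simp add: algebra_simps)
  finally show ?thesis .
qed

text \<open>On this strip the weights \<open>exp (s z)\<close>, \<open>\<bar>s\<bar> \<le> 1\<close>, all have positive real part, so the square
  root in the turning angle stays on the principal branch.\<close>
definition strip :: "complex set" where "strip = {z. \<bar>Im z\<bar> < pi / 2}"

lemma strip_props: "open strip" "convex strip" "of_real x \<in> strip"
proof -
  have *: "strip = {z. Im z < pi / 2} \<inter> {z. Im z > - (pi / 2)}" unfolding strip_def by auto
  show "open strip" unfolding * by (intro open_Int open_halfspace_Im_lt open_halfspace_Im_gt)
  show "convex strip" unfolding * by (intro convex_Int convex_halfspace_Im_lt convex_halfspace_Im_gt)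
qed (simp add: strip_def)

text \<open>Exhaustion by closed strips, required for the countability of zeros of holomorphic
  functions.\<close>

lemma fsigma_strip: "fsigma strip"
proof -
  have "strip = (\<Union>n. {z. \<bar>Im z\<bar> \<le> pi / 2 - inverse (real (Suc n))})" (is "_ = (\<Union>n. ?F n)")
  proof (intro set_eqI iffI)
    fix z assume "z \<in> strip"
    then obtain n where "inverse (real (Suc n)) < pi / 2 - \<bar>Im z\<bar>"
      using reals_Archimedean[of "pi / 2 - \<bar>Im z\<bar>"] by (auto simp: strip_def)
    then show "z \<in> (\<Union>n. ?F n)" by (intro UN_I[of n]) auto
  next
    fix z assume "z \<in> (\<Union>n. ?F n)"
    then obtain n where "\<bar>Im z\<bar> \<le> pi / 2 - inverse (real (Suc n))" by auto
    moreover have "inverse (real (Suc n)) > 0" by simp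
    ultimately show "z \<in> strip" unfolding strip_def mem_Collect_eq by linarith
  qed
  moreover have "closed (?F n)" for n by (intro closed_Collect_le continuous_intros)
  ultimately show ?thesis using fsigma.intros[of ?F] by simp
qed

section \<open>Holomorphic extension of the turning angle\<close>

definition turning_complex :: "complex \<Rightarrow> complex" where
  "turning_complex z = integral {0..pi} (\<lambda>f. inverse (csqrt (Jk 0 z ((sin f)\<^sup>2))))"

text \<open>One full turn around the level curve is an increase of \<open>f\<close> by
  \<open>pi\<close>, not by \<open>2 * pi\<close>, because \<open>(u, v)\<close> depends on
  \<open>f\<close> only modulo \<open>pi\<close>.\<close>

definition turning :: "real \<Rightarrow> real" where
  "turning m = integral {0..pi} (\<lambda>f. inverse (sqrt (Jk 0 m ((sin f)\<^sup>2))))"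

lemma sin_squared_in_01: "(sin f)\<^sup>2 \<in> {0..1::real}"
  by (auto simp: abs_square_le_1)

lemma turning_complex_of_real: "turning_complex (of_real m) = of_real (turning m)"
proof -
  have p: "Jk 0 m ((sin f)\<^sup>2) > 0" for f using Jk_pos sin_squared_in_01 by blast
  have "((\<lambda>f. inverse (sqrt (Jk 0 m ((sin f)\<^sup>2)))) has_integral turning m) {0..pi}"
    unfolding turning_def using p
    by (intro integrable_integral integrable_continuous_real continuous_intros) (auto simp: less_le)
  then have "((\<lambda>f. complex_of_real (inverse (sqrt (Jk 0 m ((sin f)\<^sup>2))))) has_integral of_real (turning m)) {0..pi}"
    by (rule has_integral_of_real)
  moreover have "inverse (csqrt (Jk 0 (of_real m) ((sin f)\<^sup>2)))
      = complex_of_real (inverse (sqrt (Jk 0 m ((sin f)\<^sup>2))))" for f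
    using p[of f] by (simp add: Jk_of_real)
  ultimately show ?thesis unfolding turning_complex_def by (simp add: integral_unique)
qed


text \<open>With \<open>integrand_deriv2\<close>, the first two \<open>z\<close>-derivatives of
  \<open>J^(-1/2)\<close>, half-integer powers being written as powers of
  \<open>csqrt\<close>.\<close>

definition integrand_deriv :: "complex \<Rightarrow> real \<Rightarrow> complex" where
  "integrand_deriv z t = - Jk 1 z t / (2 * csqrt (Jk 0 z t) ^ 3)"

definition integrand_deriv2 :: "complex \<Rightarrow> real \<Rightarrow> complex" where
  "integrand_deriv2 z t = 3 * (Jk 1 z t)\<^sup>2 / (4 * csqrt (Jk 0 z t) ^ 5) - Jk 2 z t / (2 * csqrt (Jk 0 z t) ^ 3)"

context
  fixes z t assumes zt: "z \<in> strip" "t \<in> {0..1::real}"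
begin

lemma Jk_notin: "Jk 0 z t \<notin> \<real>\<^sub>\<le>\<^sub>0" "Jk 0 z t \<noteq> 0"
  using Re_Jk_pos[of z t] zt by (auto simp: strip_def complex_nonpos_Reals_iff)

lemma csqrt_Jk_DERIV:
  "((\<lambda>z. csqrt (Jk 0 z t)) has_field_derivative Jk 1 z t / (2 * csqrt (Jk 0 z t))) (at z)"
  using has_field_derivative_csqrt'[OF Jk_DERIV Jk_notin(1)] by simp

lemma integrand_DERIV: "((\<lambda>z. inverse (csqrt (Jk 0 z t))) has_field_derivative integrand_deriv z t) (at z)"
proof -
  have n: "csqrt (Jk 0 z t) \<noteq> 0" using Jk_notin(2) by simp
  show ?thesis
    by (rule DERIV_cong[OF DERIV_inverse'[OF csqrt_Jk_DERIV n]])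
      (use n in \<open>simp add: integrand_deriv_def field_simps power3_eq_cube del: csqrt_eq_0\<close>)
qed

lemma integrand_deriv_DERIV: "((\<lambda>z. integrand_deriv z t) has_field_derivative integrand_deriv2 z t) (at z)"
proof -
  define C where "C = csqrt (Jk 0 z t)"
  have n: "C \<noteq> 0" using Jk_notin(2) by (simp add: C_def)
  have J: "((\<lambda>z. - Jk 1 z t) has_field_derivative - Jk 2 z t) (at z)"
    using DERIV_minus[OF Jk_DERIV[of 1 t z]] by (simp add: numeral_2_eq_2)
  have D: "((\<lambda>z. 2 * csqrt (Jk 0 z t) ^ 3) has_field_derivative
      2 * (of_nat 3 * (Jk 1 z t / (2 * C) * C ^ (3 - Suc 0)))) (at z)"
    unfolding C_def by (intro DERIV_cmult DERIV_power csqrt_Jk_DERIV)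
  have n': "2 * csqrt (Jk 0 z t) ^ 3 \<noteq> 0" using n by (simp add: C_def)
  have "((\<lambda>z. integrand_deriv z t) has_field_derivative
      (- Jk 2 z t * (2 * C ^ 3) - - Jk 1 z t * (2 * (of_nat 3 * (Jk 1 z t / (2 * C) * C ^ (3 - Suc 0)))))
        / (2 * C ^ 3 * (2 * C ^ 3))) (at z)"
    unfolding integrand_deriv_def using DERIV_divide[OF J D n'] unfolding C_def by simp
  moreover have "(- Jk 2 z t * (2 * C ^ 3) - - Jk 1 z t * (2 * (of_nat 3 * (Jk 1 z t / (2 * C) * C ^ (3 - Suc 0)))))
        / (2 * C ^ 3 * (2 * C ^ 3)) = integrand_deriv2 z t"
    unfolding integrand_deriv2_def C_def[symmetric] using n by (simp add: divide_simps) (simp add: eval_nat_numeral algebra_simps)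
  ultimately show ?thesis by simp
qed

end

text \<open>Leibniz rule used for both derivatives. Since the strip is open, the derivative within
  it is a derivative at the point.\<close>

lemma integral_strip_DERIV:
  fixes G :: "complex \<Rightarrow> real \<Rightarrow> complex"
  assumes "\<And>z t. z \<in> strip \<Longrightarrow> t \<in> {0..1} \<Longrightarrow> ((\<lambda>z. G z t) has_field_derivative G' z t) (at z)"
    and "continuous_on (strip \<times> {0..1}) (\<lambda>(z, t). G' z t)"
    and "continuous_on (strip \<times> {0..1}) (\<lambda>(z, t). G z t)"
    and z: "z \<in> strip"
  shows "((\<lambda>z. integral {0..pi} (\<lambda>f. G z ((sin f)\<^sup>2))) has_field_derivative
    integral {0..pi} (\<lambda>f. G' z ((sin f)\<^sup>2))) (at z)"
proof -
  have sin: "(sin f)\<^sup>2 \<in> {0..1}" for f :: real by (rule sin_squared_in_01)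
  have "((\<lambda>z. integral (cbox 0 pi) (\<lambda>f. G z ((sin f)\<^sup>2))) has_field_derivative
    integral (cbox 0 pi) (\<lambda>f. G' z ((sin f)\<^sup>2))) (at z within strip)"
  proof (rule leibniz_rule_field_derivative)
    show "((\<lambda>x. G x ((sin t)\<^sup>2)) has_field_derivative G' x ((sin t)\<^sup>2)) (at x within strip)"
      if "x \<in> strip" for x t
      using assms(1)[OF that sin] by (rule has_field_derivative_at_within)
    have c: "continuous_on (strip \<times> S) (\<lambda>(x, t). K x ((sin t)\<^sup>2))"
      if "continuous_on (strip \<times> {0..1}) (\<lambda>(z, t). K z t)" for K :: "complex \<Rightarrow> real \<Rightarrow> complex" and S
    proof -
      have "continuous_on (strip \<times> S) (\<lambda>p. (\<lambda>(z, t). K z t) (fst p, (sin (snd p))\<^sup>2))"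
        by (rule continuous_on_compose2[OF that]) (auto intro!: continuous_intros simp: abs_square_le_1)
      then show ?thesis by (simp add: split_beta)
    qed
    show "continuous_on (strip \<times> cbox 0 pi) (\<lambda>(x, t). G' x ((sin t)\<^sup>2))"
      by (rule c[OF assms(2)])
    show "(\<lambda>f. G x ((sin f)\<^sup>2)) integrable_on cbox 0 pi" if "x \<in> strip" for x
    proof (rule integrable_continuous)
      have "continuous_on (cbox 0 pi) (\<lambda>f. (\<lambda>(z, t). G z ((sin t)\<^sup>2)) (x, f))"
        by (rule continuous_on_compose2[OF c[OF assms(3)]]) (auto intro!: continuous_intros that)
      then show "continuous_on (cbox 0 pi) (\<lambda>f. G x ((sin f)\<^sup>2))" by simp
    qed
  qed (use z strip_props in auto)
  then show ?thesis using at_within_open[OF z strip_props(1)] by simp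
qed

lemma continuous_csqrt_Jk: "continuous_on (strip \<times> {0..1}) (\<lambda>p. csqrt (Jk 0 (fst p) (snd p)))"
  by (rule continuous_on_compose2[OF continuous_on_csqrt])
    (use Jk_notin(1) in \<open>auto intro!: continuous_intros\<close>)

lemma continuous_csqrt_Jk_power [continuous_intros]:
  "continuous_on (strip \<times> {0..1}) (\<lambda>p. csqrt (Jk 0 (fst p) (snd p)) ^ n)"
  by (intro continuous_on_power continuous_csqrt_Jk)

lemma csqrt_Jk_nz: "p \<in> strip \<times> {0..1} \<Longrightarrow> csqrt (Jk 0 (fst p) (snd p)) \<noteq> 0"
  using Jk_notin(2)[of "fst p" "snd p"] by (auto simp: mem_Times_iff)

lemma continuous_on_integrand_deriv: "continuous_on (strip \<times> {0..1}) (\<lambda>(z, t). integrand_deriv z t)"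
  unfolding integrand_deriv_def split_beta
  by (intro continuous_intros) (use csqrt_Jk_nz in fastforce)

lemma continuous_on_integrand_deriv2: "continuous_on (strip \<times> {0..1}) (\<lambda>(z, t). integrand_deriv2 z t)"
  unfolding integrand_deriv2_def split_beta
  by (intro continuous_intros) (use csqrt_Jk_nz in fastforce)+

lemma turning_complex_DERIV:
  assumes "z \<in> strip"
  shows "(turning_complex has_field_derivative integral {0..pi} (\<lambda>f. integrand_deriv z ((sin f)\<^sup>2))) (at z)"
proof -
  have "continuous_on (strip \<times> {0..1}) (\<lambda>(z, t). inverse (csqrt (Jk 0 z t)))"
    unfolding split_beta
    by (intro continuous_on_inverse continuous_csqrt_Jk) (use csqrt_Jk_nz in blast)
  from integral_strip_DERIV[OF integrand_DERIV continuous_on_integrand_deriv this assms]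
  show ?thesis unfolding turning_complex_def by simp
qed

lemma turning_complex_DERIV2:
  assumes "z \<in> strip"
  shows "((\<lambda>z. integral {0..pi} (\<lambda>f. integrand_deriv z ((sin f)\<^sup>2))) has_field_derivative
    integral {0..pi} (\<lambda>f. integrand_deriv2 z ((sin f)\<^sup>2))) (at z)"
  using integral_strip_DERIV[OF integrand_deriv_DERIV continuous_on_integrand_deriv2 continuous_on_integrand_deriv assms] by simp

lemma turning_complex_holomorphic: "turning_complex holomorphic_on strip"
  using turning_complex_DERIV strip_props(1) by (auto simp: holomorphic_on_open)

section \<open>Non-constancy and countable level sets of the turning angle\<close>

text \<open>Here \<open>J = 1/2\<close>. With \<open>q = t (1 - t)\<close> the two terms are
  \<open>(1 - 4 q) / 12\<close> and \<open>(1 - 3 q) / 12\<close> over \<open>csqrt (1/2)\<close>;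
  their constant parts cancel, which leaves an expression of one sign.\<close>

lemma integrand_deriv2_at_0: "integrand_deriv2 0 t = - of_real (sqrt 2 / 12 * (t * (1 - t)))"
proof -
  define C where "C = csqrt (1/2)"
  have C: "C = of_real (sqrt 2 / 2)"
    unfolding C_def using csqrt_of_real_nonneg[of "1/2"] by (simp add: real_sqrt_divide)
      (simp add: field_simps flip: of_real_mult)
  have C2: "C ^ 2 = 1/2" unfolding C_def by (rule power2_csqrt)
  then have C0: "C \<noteq> 0" by auto
  have C3: "C ^ 3 = C / 2" using power_add[of C 2 1] unfolding C2 by simp
  have C5: "C ^ 5 = C / 4" using power_add[of C 2 3] unfolding C2 C3 by simp
  have J: "Jk 0 (0::complex) t = 1/2" "Jk 1 (0::complex) t = of_real ((2 * t - 1) / 6)"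
    "Jk 2 (0::complex) t = of_real ((1 - 3 * (t * (1 - t))) / 12)"
    unfolding Jk_def by (simp_all add: phi_at_0 phi_at_0[unfolded One_nat_def numeral_2_eq_2] complex_eq_iff field_simps
      eval_nat_numeral)
  have "integrand_deriv2 0 t = (3 * (of_real ((2 * t - 1) / 6))\<^sup>2 - of_real ((1 - 3 * (t * (1 - t))) / 12)) / C"
    unfolding integrand_deriv2_def J C_def[symmetric] C3 C5 using C0 by (simp add: field_simps)
  also have "3 * (of_real ((2 * t - 1) / 6))\<^sup>2 - of_real ((1 - 3 * (t * (1 - t))) / 12)
      = complex_of_real (3 * ((2 * t - 1) / 6)\<^sup>2 - (1 - 3 * (t * (1 - t))) / 12)" by simp
  also have "3 * ((2 * t - 1) / 6)\<^sup>2 - (1 - 3 * (t * (1 - t))) / 12 = - (t * (1 - t)) / 12"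
    by (simp add: power2_eq_square field_simps)
  also have "of_real (- (t * (1 - t)) / 12) / C = complex_of_real (- (t * (1 - t)) / 12 / (sqrt 2 / 2))"
    unfolding C by simp
  also have "- (t * (1 - t)) / 12 / (sqrt 2 / 2) = - (sqrt 2 / 12 * (t * (1 - t)))"
  proof -
    have "x / (sqrt 2 / 2) = x * sqrt 2" for x :: real
      by (metis divide_divide_eq_right times_divide_eq_right real_div_sqrt zero_le_numeral)
    from this[of "- (t * (1 - t)) / 12"] show ?thesis by simp
  qed
  finally show ?thesis by simp
qed

text \<open>Constancy would make the first derivative vanish on the strip and hence the second at
  \<open>0\<close>, but the latter is minus the integral of a positive multiple of
  \<open>(sin f)^2 (cos f)^2\<close>.\<close>

lemma turning_complex_not_constant: "\<not> turning_complex constant_on strip"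
proof
  assume "turning_complex constant_on strip"
  then obtain c where c: "\<And>z. z \<in> strip \<Longrightarrow> turning_complex z = c" by (auto simp: constant_on_def)
  have D0: "integral {0..pi} (\<lambda>f. integrand_deriv z ((sin f)\<^sup>2)) = 0" if "z \<in> strip" for z
  proof -
    have "(turning_complex has_field_derivative 0) (at z)"
      by (rule has_field_derivative_transform_within_open[OF _ strip_props(1) that])
        (auto simp: c intro: DERIV_const)
    then show ?thesis using turning_complex_DERIV[OF that] DERIV_unique by blast
  qed
  have z: "0 \<in> strip" using strip_props(3)[of 0] by simp
  have "((\<lambda>z. integral {0..pi} (\<lambda>f. integrand_deriv z ((sin f)\<^sup>2))) has_field_derivative 0) (at 0)"
    by (rule has_field_derivative_transform_within_open[OF _ strip_props(1) z, of "\<lambda>_. 0"]) (auto simp: D0)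
  then have i: "integral {0..pi} (\<lambda>f. integrand_deriv2 0 ((sin f)\<^sup>2)) = 0"
    using turning_complex_DERIV2[OF z] DERIV_unique by blast
  define h where "h f = sqrt 2 / 12 * ((sin f)\<^sup>2 * (1 - (sin f)\<^sup>2))" for f :: real
  have h0: "h f \<ge> 0" for f unfolding h_def using sin_squared_in_01[of f] by (intro mult_nonneg_nonneg) auto
  have hc: "continuous_on S h" for S unfolding h_def by (intro continuous_intros)
  have hI: "(h has_integral integral {0..pi} h) {0..pi}"
    by (intro integrable_integral integrable_continuous_real hc)
  then have "((\<lambda>f. - complex_of_real (h f)) has_integral - complex_of_real (integral {0..pi} h)) {0..pi}"
    by (intro has_integral_neg has_integral_of_real)
  then have "- complex_of_real (integral {0..pi} h) = 0"
    using i unfolding integrand_deriv2_at_0 h_def[symmetric] by (metis integral_unique)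
  then have "integral {0..pi} h = 0" by simp
  with hI have "(h has_integral 0) (cbox 0 pi)" by simp
  moreover have ne: "box 0 pi \<noteq> {}" 
  proof -
    have "pi / 2 \<in> box 0 pi" by simp
    then show ?thesis by blast
  qed
  \<comment> \<open>The continuous nonnegative \<open>h\<close> would have to vanish everywhere; at
    \<open>pi / 4\<close>, where \<open>(sin f)^2 = 1/2\<close>, it does not.\<close>
  ultimately have "h (pi / 4) = 0"
    by (rule has_integral_0_cbox_imp_0[rotated 2]) (use ne in \<open>auto intro: hc h0\<close>)
  then show False by (simp add: h_def sin_45 power_divide)
qed

text \<open>The real solutions lie among the zeros of a non-constant holomorphic function on the
  connected strip.\<close>

lemma countable_turning_level: "countable {m. turning m = r}"
proof -
  have "countable {z \<in> strip. turning_complex z - of_real r = 0}"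
  proof (rule holomorphic_countable_zeros)
    show "(\<lambda>z. turning_complex z - of_real r) holomorphic_on strip"
      by (intro holomorphic_intros turning_complex_holomorphic)
    show "\<not> (\<lambda>z. turning_complex z - of_real r) constant_on strip"
    proof
      assume "(\<lambda>z. turning_complex z - of_real r) constant_on strip"
      then obtain c where "\<And>z. z \<in> strip \<Longrightarrow> turning_complex z - of_real r = c" by (auto simp: constant_on_def)
      then have "\<And>z. z \<in> strip \<Longrightarrow> turning_complex z = c + of_real r" by (simp add: algebra_simps)
      then show False using turning_complex_not_constant by (auto simp: constant_on_def)
    qed
  qed (auto intro: strip_props convex_connected fsigma_strip)
  moreover have "of_real ` {m. turning m = r} \<subseteq> {z \<in> strip. turning_complex z - of_real r = 0}"
    using strip_props(3) by (auto simp: turning_complex_of_real)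
  ultimately have "countable (complex_of_real ` {m. turning m = r})" by (rule countable_subset[rotated])
  then show ?thesis by (rule countable_image_inj_on) (auto simp: inj_on_def)
qed

lemma continuous_on_turning: "continuous_on S turning"
proof -
  have "continuous_on S (\<lambda>m. turning_complex (of_real m))"
    by (rule continuous_on_compose2[OF holomorphic_on_imp_continuous_on[OF turning_complex_holomorphic]])
      (auto intro!: continuous_intros strip_props(3))
  then have "continuous_on S (\<lambda>m. Re (turning_complex (of_real m)))" by (rule continuous_on_Re)
  then show ?thesis by (simp add: turning_complex_of_real)
qed

section \<open>Uniqueness, antiderivatives and the reflection symmetry\<close>

lemma is_sol_iff:
  "is_sol (\<lambda>t. (X t, U t, V t)) \<longleftrightarrow>
    (\<forall>t. (X has_real_derivative sin (X t) * U t - cos (X t) * V t) (at t)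
      \<and> (U has_real_derivative cos (X t)) (at t) \<and> (V has_real_derivative sin (X t)) (at t))"
  (is "_ \<longleftrightarrow> ?R")
proof
  assume s: "is_sol (\<lambda>t. (X t, U t, V t))"
  have *: "((\<lambda>t. (X t, U t, V t)) has_vector_derivative
      (sin (X t) * U t - cos (X t) * V t, cos (X t), sin (X t))) (at t)" for t
    using s by (simp add: is_sol_def F_def)
  show ?R
    using bounded_linear.has_vector_derivative[OF bounded_linear_fst *]
      bounded_linear.has_vector_derivative[OF bounded_linear_fst
        bounded_linear.has_vector_derivative[OF bounded_linear_snd *]]
      bounded_linear.has_vector_derivative[OF bounded_linear_snd
        bounded_linear.has_vector_derivative[OF bounded_linear_snd *]]
    by (simp add: has_real_derivative_iff_has_vector_derivative)
next
  assume ?R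
  then show "is_sol (\<lambda>t. (X t, U t, V t))"
    by (auto simp: is_sol_def F_def has_real_derivative_iff_has_vector_derivative
        intro!: has_vector_derivative_Pair)
qed

lemma sol_cases:
  assumes "is_sol \<gamma>"
  obtains X U V where "\<gamma> = (\<lambda>t. (X t, U t, V t))"
    "\<And>t. (X has_real_derivative sin (X t) * U t - cos (X t) * V t) (at t)"
    "\<And>t. (U has_real_derivative cos (X t)) (at t)"
    "\<And>t. (V has_real_derivative sin (X t)) (at t)"
proof
  show eq: "\<gamma> = (\<lambda>t. (fst (\<gamma> t), fst (snd (\<gamma> t)), snd (snd (\<gamma> t))))" by simp
  show "((\<lambda>t. fst (\<gamma> t)) has_real_derivative
      sin (fst (\<gamma> t)) * fst (snd (\<gamma> t)) - cos (fst (\<gamma> t)) * snd (snd (\<gamma> t))) (at t)"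
    "((\<lambda>t. fst (snd (\<gamma> t))) has_real_derivative cos (fst (\<gamma> t))) (at t)"
    "((\<lambda>t. snd (snd (\<gamma> t))) has_real_derivative sin (fst (\<gamma> t))) (at t)" for t
    using assms is_sol_iff[of "\<lambda>t. fst (\<gamma> t)" "\<lambda>t. fst (snd (\<gamma> t))" "\<lambda>t. snd (snd (\<gamma> t))"]
    by auto
qed

section \<open>Uniqueness of solutions\<close>

text \<open>\<open>exp (- K * s) * D s\<close> is nonincreasing to the right of \<open>0\<close> and
  \<open>exp (K * s) * D s\<close> nondecreasing to the left. The bound is asked only up to
  \<open>\<bar>t\<bar>\<close>, as the Lipschitz constant along a solution is local.\<close>

lemma gronwall_zero:
  fixes D :: "real \<Rightarrow> real"
  assumes der: "\<And>s. (D has_real_derivative D' s) (at s)"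
    and bound: "\<And>s. \<bar>s\<bar> \<le> \<bar>t\<bar> \<Longrightarrow> \<bar>D' s\<bar> \<le> K * D s"
    and D0: "D 0 = 0" and pos: "D t \<ge> 0"
  shows "D t = 0"
proof -
  have "D t \<le> 0"
  proof (cases "t \<ge> 0")
    case True
    have "exp (- K * t) * D t \<le> exp (- K * 0) * D 0"
    proof (rule DERIV_nonpos_imp_nonincreasing[OF True])
      fix s assume s: "0 \<le> s" "s \<le> t"
      have "((\<lambda>s. exp (- K * s) * D s) has_real_derivative exp (- K * s) * (D' s - K * D s)) (at s)"
        by (auto intro!: derivative_eq_intros der simp: algebra_simps)
      moreover have "D' s - K * D s \<le> 0" using bound[of s] s by auto
      ultimately show "\<exists>y. ((\<lambda>s. exp (- K * s) * D s) has_real_derivative y) (at s) \<and> y \<le> 0"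
        by (auto intro!: exI mult_nonneg_nonpos)
    qed
    then show ?thesis by (simp add: D0 mult_le_0_iff)
  next
    case False
    then have t: "t \<le> 0" by simp
    have "exp (K * t) * D t \<le> exp (K * 0) * D 0"
    proof (rule DERIV_nonneg_imp_nondecreasing[OF t])
      fix s assume s: "t \<le> s" "s \<le> 0"
      have "((\<lambda>s. exp (K * s) * D s) has_real_derivative exp (K * s) * (D' s + K * D s)) (at s)"
        by (auto intro!: derivative_eq_intros der simp: algebra_simps)
      moreover have "D' s + K * D s \<ge> 0" using bound[of s] s by auto
      ultimately show "\<exists>y. ((\<lambda>s. exp (K * s) * D s) has_real_derivative y) (at s) \<and> y \<ge> 0"
        by (auto intro!: exI mult_nonneg_nonneg)
    qed
    then show ?thesis by (simp add: D0 mult_le_0_iff)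
  qed
  with pos show ?thesis by simp
qed

lemma abs_sin_diff_le: "\<bar>sin x - sin y\<bar> \<le> \<bar>x - y\<bar>" for x y :: real
proof -
  have "sin x - sin y = 2 * sin ((x - y) / 2) * cos ((x + y) / 2)" by (rule sin_diff_sin)
  then have "\<bar>sin x - sin y\<bar> = 2 * (\<bar>sin ((x - y) / 2)\<bar> * \<bar>cos ((x + y) / 2)\<bar>)" by (simp add: abs_mult)
  also have "\<dots> \<le> 2 * (\<bar>(x - y) / 2\<bar> * 1)"
    by (intro mult_left_mono mult_mono abs_sin_x_le_abs_x abs_cos_le_one) auto
  finally show ?thesis by simp
qed

lemma abs_cos_diff_le: "\<bar>cos x - cos y\<bar> \<le> \<bar>x - y\<bar>" for x y :: real
  using abs_sin_diff_le[of "x + pi / 2" "y + pi / 2"] by (simp add: sin_add)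

text \<open>Gronwall for the squared distance. The field is only locally Lipschitz, but after
  splitting the difference of the \<open>X\<close> equations only \<open>U2\<close> and
  \<open>V2\<close> multiply differences of sines and cosines, so a bound \<open>B\<close> for one
  solution on a compact interval is enough.\<close>

lemma sol_unique:
  assumes "is_sol \<gamma>" "is_sol \<delta>" "\<gamma> 0 = \<delta> 0" shows "\<gamma> = \<delta>"
proof
  fix t
  obtain X1 U1 V1 where 1: "\<gamma> = (\<lambda>t. (X1 t, U1 t, V1 t))"
    and d1: "\<And>t. (X1 has_real_derivative sin (X1 t) * U1 t - cos (X1 t) * V1 t) (at t)"
    "\<And>t. (U1 has_real_derivative cos (X1 t)) (at t)" "\<And>t. (V1 has_real_derivative sin (X1 t)) (at t)"
    using sol_cases[OF assms(1)] by blast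
  obtain X2 U2 V2 where 2: "\<delta> = (\<lambda>t. (X2 t, U2 t, V2 t))"
    and d2: "\<And>t. (X2 has_real_derivative sin (X2 t) * U2 t - cos (X2 t) * V2 t) (at t)"
    "\<And>t. (U2 has_real_derivative cos (X2 t)) (at t)" "\<And>t. (V2 has_real_derivative sin (X2 t)) (at t)"
    using sol_cases[OF assms(2)] by blast
  have "continuous_on {- \<bar>t\<bar>..\<bar>t\<bar>} (\<lambda>s. \<bar>U2 s\<bar> + \<bar>V2 s\<bar>)"
    using DERIV_isCont[OF d2(2)] DERIV_isCont[OF d2(3)]
    by (intro continuous_intros continuous_at_imp_continuous_on) auto
  then have "bounded ((\<lambda>s. \<bar>U2 s\<bar> + \<bar>V2 s\<bar>) ` {- \<bar>t\<bar>..\<bar>t\<bar>})"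
    by (intro compact_imp_bounded compact_continuous_image) auto
  then obtain B where B': "\<forall>y \<in> (\<lambda>s. \<bar>U2 s\<bar> + \<bar>V2 s\<bar>) ` {- \<bar>t\<bar>..\<bar>t\<bar>}. norm y \<le> B"
    unfolding bounded_iff by blast
  have B: "\<bar>U2 s\<bar> + \<bar>V2 s\<bar> \<le> B" if "\<bar>s\<bar> \<le> \<bar>t\<bar>" for s
  proof -
    have "s \<in> {- \<bar>t\<bar>..\<bar>t\<bar>}" using that by auto
    with B' show ?thesis by fastforce
  qed
  define x where "x s = X1 s - X2 s" for s
  define u where "u s = U1 s - U2 s" for s
  define v where "v s = V1 s - V2 s" for s
  define x' where "x' s = (sin (X1 s) * U1 s - cos (X1 s) * V1 s) - (sin (X2 s) * U2 s - cos (X2 s) * V2 s)" for s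
  define D where "D s = (x s)\<^sup>2 + (u s)\<^sup>2 + (v s)\<^sup>2" for s
  define D' where "D' s = 2 * (x s * x' s + u s * (cos (X1 s) - cos (X2 s)) + v s * (sin (X1 s) - sin (X2 s)))" for s
  have "D t = 0"
  \<comment> \<open>\<open>2 * B\<close> comes from the term with \<open>B\<close>; the
    \<open>4\<close> absorbs the mixed products by \<open>4 a b \<le> 2 a^2 + 2 b^2\<close>.\<close>
  proof (rule gronwall_zero[where D = D and D' = D' and K = "2 * B + 4"])
    show "(D has_real_derivative D' s) (at s)" for s
      unfolding D_def D'_def x_def u_def v_def x'_def
      by (auto intro!: derivative_eq_intros d1 d2 simp: algebra_simps)
    show "D 0 = 0" using assms(3) by (simp add: 1 2 D_def x_def u_def v_def)
    show "D t \<ge> 0" by (simp add: D_def)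
    fix s assume s: "\<bar>s\<bar> \<le> \<bar>t\<bar>"
    have b: "\<bar>U2 s\<bar> + \<bar>V2 s\<bar> \<le> B" using B s by blast
    let ?S = "sin (X1 s) - sin (X2 s)" and ?C = "cos (X1 s) - cos (X2 s)"
    have S: "\<bar>?S\<bar> \<le> \<bar>x s\<bar>" "\<bar>?C\<bar> \<le> \<bar>x s\<bar>"
      by (simp_all add: x_def abs_sin_diff_le abs_cos_diff_le)
    have "x' s = sin (X1 s) * u s - cos (X1 s) * v s + (?S * U2 s - ?C * V2 s)"
      by (simp add: x'_def u_def v_def algebra_simps)
    then have "\<bar>x' s\<bar> \<le> \<bar>sin (X1 s)\<bar> * \<bar>u s\<bar> + \<bar>cos (X1 s)\<bar> * \<bar>v s\<bar> + (\<bar>?S\<bar> * \<bar>U2 s\<bar> + \<bar>?C\<bar> * \<bar>V2 s\<bar>)"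
      unfolding abs_mult[symmetric] by linarith
    also have "\<dots> \<le> 1 * \<bar>u s\<bar> + 1 * \<bar>v s\<bar> + (\<bar>x s\<bar> * \<bar>U2 s\<bar> + \<bar>x s\<bar> * \<bar>V2 s\<bar>)"
      by (intro add_mono mult_right_mono S) auto
    also have "\<dots> = \<bar>u s\<bar> + \<bar>v s\<bar> + \<bar>x s\<bar> * (\<bar>U2 s\<bar> + \<bar>V2 s\<bar>)" by (simp add: algebra_simps)
    also have "\<dots> \<le> \<bar>u s\<bar> + \<bar>v s\<bar> + \<bar>x s\<bar> * B" using b by (intro add_left_mono mult_left_mono) auto
    finally have x': "\<bar>x' s\<bar> \<le> \<bar>u s\<bar> + \<bar>v s\<bar> + \<bar>x s\<bar> * B" .
    have "\<bar>D' s\<bar> \<le> 2 * (\<bar>x s\<bar> * \<bar>x' s\<bar> + \<bar>u s\<bar> * \<bar>?C\<bar> + \<bar>v s\<bar> * \<bar>?S\<bar>)"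
    proof -
      have "\<bar>2 * (a + b + c)\<bar> \<le> 2 * (\<bar>a\<bar> + \<bar>b\<bar> + \<bar>c\<bar>)" for a b c :: real
        by (auto simp: abs_if)
      then show ?thesis unfolding D'_def abs_mult[symmetric] .
    qed
    also have "\<dots> \<le> 2 * (\<bar>x s\<bar> * (\<bar>u s\<bar> + \<bar>v s\<bar> + \<bar>x s\<bar> * B) + \<bar>u s\<bar> * \<bar>x s\<bar> + \<bar>v s\<bar> * \<bar>x s\<bar>)"
      by (intro mult_left_mono add_mono S x') auto
    also have "\<dots> = 2 * B * \<bar>x s\<bar>\<^sup>2 + 4 * \<bar>x s\<bar> * \<bar>u s\<bar> + 4 * \<bar>x s\<bar> * \<bar>v s\<bar>"
      by (simp add: power2_eq_square algebra_simps)
    also have "\<dots> \<le> (2 * B + 4) * (\<bar>x s\<bar>\<^sup>2 + \<bar>u s\<bar>\<^sup>2 + \<bar>v s\<bar>\<^sup>2)"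
    proof -
      have "2 * B * a\<^sup>2 + 4 * a * b + 4 * a * c \<le> (2 * B + 4) * (a\<^sup>2 + b\<^sup>2 + c\<^sup>2)" for a b c :: real
      proof -
        have "(2 * B + 4) * (a\<^sup>2 + b\<^sup>2 + c\<^sup>2) - (2 * B * a\<^sup>2 + 4 * a * b + 4 * a * c)
            = 2 * (a - b)\<^sup>2 + 2 * (a - c)\<^sup>2 + 2 * (B + 1) * (b\<^sup>2 + c\<^sup>2)"
          by (simp add: power2_eq_square algebra_simps)
        moreover have "B \<ge> 0" using b by linarith
        then have "0 \<le> 2 * (a - b)\<^sup>2 + 2 * (a - c)\<^sup>2 + 2 * (B + 1) * (b\<^sup>2 + c\<^sup>2)"
          by (intro add_nonneg_nonneg mult_nonneg_nonneg) auto
        ultimately show ?thesis by linarith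
      qed
      then show ?thesis .
    qed
    finally show "\<bar>D' s\<bar> \<le> (2 * B + 4) * D s" by (simp add: D_def)
  qed
  then have "x t = 0" "u t = 0" "v t = 0"
    by (simp_all add: D_def add_nonneg_eq_0_iff)
  then show "\<gamma> t = \<delta> t" by (simp add: 1 2 x_def u_def v_def)
qed

section \<open>Antiderivatives of periodic functions and their inverses\<close>

lemma ex_antiderivative:
  fixes f :: "real \<Rightarrow> real"
  assumes "continuous_on UNIV f"
  obtains G where "\<And>x. (G has_real_derivative f x) (at x)"
  using einterval_antiderivative[of "-\<infinity>" \<infinity> f] assms
  by (auto simp: has_real_derivative_iff_has_vector_derivative continuous_on_eq_continuous_at)

text \<open>\<open>G (x + P) - G x\<close> has derivative \<open>0\<close>. Applied later to the
  swept angle and to the elapsed time, both integrals of functions of period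
  \<open>pi\<close>.\<close>

lemma antiderivative_periodic_shift:
  fixes f :: "real \<Rightarrow> real"
  assumes der: "\<And>x. (G has_real_derivative f x) (at x)" and per: "\<And>x. f (x + P) = f x"
  shows "G (x + of_int n * P) = G x + of_int n * (G P - G 0)"
proof -
  have "((\<lambda>x. G (x + P) - G x) has_real_derivative 0) (at x)" for x
    using der[of "x + P"] der[of x] by (auto intro!: derivative_eq_intros DERIV_shift[THEN iffD1] simp: per)
  then have *: "G (x + P) = G x + (G P - G 0)" for x
    using DERIV_isconst_all[of "\<lambda>x. G (x + P) - G x" x 0] by (simp add: algebra_simps)
  show ?thesis
  proof (induction n arbitrary: x rule: int_induct[of _ 0])
    case base show ?case by simp
  next
    case (step1 i) have "G (x + of_int (i + 1) * P) = G (x + of_int i * P + P)" by (simp add: algebra_simps)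
    also have "\<dots> = G x + of_int (i + 1) * (G P - G 0)" unfolding * step1 by (simp add: algebra_simps)
    finally show ?case .
  next
    case (step2 i) have "G (x + of_int i * P) = G (x + of_int (i - 1) * P + P)" by (simp add: algebra_simps)
    then have "G (x + of_int (i - 1) * P) = G x + of_int i * (G P - G 0) - (G P - G 0)"
      unfolding * step2 by simp
    then show ?case by (simp add: algebra_simps)
  qed
qed

text \<open>Separation of variables for \<open>T' = 1 / f T\<close>. The uniform lower bound
  \<open>b\<close> gives \<open>G\<close> at least linear growth, hence all of the reals as range,
  so that \<open>T\<close> is defined for all times.\<close>

lemma ex_inverse_of_antiderivative:
  fixes f :: "real \<Rightarrow> real"
  assumes der: "\<And>x. (G has_real_derivative f x) (at x)" and lower: "\<And>x. f x \<ge> b" and b: "b > 0"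
  obtains T where "\<And>x. T (G x) = x" "\<And>t. G (T t) = t"
    "\<And>t. (T has_real_derivative inverse (f (T t))) (at t)"
proof -
  have fpos: "f x > 0" for x using lower[of x] b by linarith
  have mono: "G x < G y" if "x < y" for x y
    using that DERIV_pos_imp_increasing[of x y G] der fpos by blast
  have growth: "b * (y - x) \<le> G y - G x" if "x \<le> y" for x y
  proof -
    have "G x - b * x \<le> G y - b * y"
    proof (rule DERIV_nonneg_imp_nondecreasing[OF that])
      fix z
      have "((\<lambda>x. G x - b * x) has_real_derivative f z - b) (at z)"
        by (auto intro!: derivative_eq_intros der)
      then show "\<exists>w. ((\<lambda>x. G x - b * x) has_real_derivative w) (at z) \<and> w \<ge> 0"
        using lower[of z] by auto
    qed
    then show ?thesis by (simp add: algebra_simps)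
  qed
  have "\<exists>x. G x = t" for t
  proof -
    define r where "r = \<bar>t - G 0\<bar> / b"
    have r: "r \<ge> 0" "b * r = \<bar>t - G 0\<bar>" using b by (auto simp: r_def)
    have "G (- r) \<le> t" "t \<le> G r" using growth[of "- r" 0] growth[of 0 r] r by (auto simp: abs_if split: if_splits)
    moreover have "\<forall>x. - r \<le> x \<and> x \<le> r \<longrightarrow> isCont G x" using DERIV_isCont[OF der] by blast
    ultimately show ?thesis using IVT[of G "- r" t r] r by auto
  qed
  then obtain T where GT: "\<And>t. G (T t) = t" by metis
  have TG: "T (G x) = x" for x
    using mono[of "T (G x)" x] mono[of x "T (G x)"] GT[of "G x"] by (metis less_irrefl linorder_less_linear)
  have "(T has_real_derivative inverse (f (T t))) (at t)" for t
  proof (rule DERIV_inverse_function[where a = "t - 1" and b = "t + 1"])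
    show "(G has_real_derivative f (T t)) (at (T t))" by (rule der)
    have "isCont T (G (T t))"
      by (rule isCont_inverse_function[where d = 1]) (auto simp: TG intro: DERIV_isCont der)
    then show "isCont T t" by (simp add: GT)
  qed (use fpos[of "T t"] in \<open>auto simp: GT\<close>)
  with TG GT show ?thesis using that by blast
qed

text \<open>The reflection is a symmetry of the vector field and exchanges the two signs of \<open>v\<close>, which
  reduces everything to the sign \<open>Plus\<close>.\<close>
definition reflect :: "real \<times> real \<times> real \<Rightarrow> real \<times> real \<times> real" where
  "reflect p = (case p of (x, u, v) \<Rightarrow> (- x, u, - v))"

lemma reflect_simps [simp]: "reflect (x, u, v) = (- x, u, - v)" "reflect (reflect p) = p"
  by (auto simp: reflect_def split: prod.splits)

fun flip :: "sign \<Rightarrow> sign" where "flip Plus = Minus" | "flip Minus = Plus"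

lemma flip_flip [simp]: "flip (flip \<alpha>) = \<alpha>" by (cases \<alpha>) auto

lemma is_sol_reflect: "is_sol \<gamma> \<Longrightarrow> is_sol (reflect \<circ> \<gamma>)"
proof (erule sol_cases)
  fix X U V assume "\<gamma> = (\<lambda>t. (X t, U t, V t))"
    and d: "\<And>t. (X has_real_derivative sin (X t) * U t - cos (X t) * V t) (at t)"
    "\<And>t. (U has_real_derivative cos (X t)) (at t)" "\<And>t. (V has_real_derivative sin (X t)) (at t)"
  then have eq: "reflect \<circ> \<gamma> = (\<lambda>t. (- X t, U t, - V t))" by auto
  show ?thesis unfolding eq is_sol_iff by (auto intro!: derivative_eq_intros d)
qed

lemma Hset_flip: "(u, v) \<in> Hset \<alpha> c \<longleftrightarrow> (u, - v) \<in> Hset (flip \<alpha>) c"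
  by (cases \<alpha>) (auto simp: H_def)

text \<open>Undoing the rotation turns membership into a condition on the rotating-frame
  coordinates.\<close>

lemma Tset_iff: "(x, u, v) \<in> Tset \<alpha> c \<longleftrightarrow> (cos x * u + sin x * v, cos x * v - sin x * u) \<in> Hset \<alpha> c"
proof -
  have id: "cos x * (cos x * a + sin x * b) - sin x * (cos x * b - sin x * a) = a"
    "sin x * (cos x * a + sin x * b) + cos x * (cos x * b - sin x * a) = b"
    "cos x * (cos x * a - sin x * b) + sin x * (sin x * a + cos x * b) = a"
    "cos x * (sin x * a + cos x * b) - sin x * (cos x * a - sin x * b) = b" for a b :: real
    using sin_cos_squared_add[of x] by algebra+
  show ?thesis
  proof
    assume "(x, u, v) \<in> Tset \<alpha> c"
    then show "(cos x * u + sin x * v, cos x * v - sin x * u) \<in> Hset \<alpha> c"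
      by (auto simp: Tset_def rot_def id)
  next
    assume "(cos x * u + sin x * v, cos x * v - sin x * u) \<in> Hset \<alpha> c"
    moreover have "(u, v) = rot x (cos x * u + sin x * v, cos x * v - sin x * u)" by (simp add: rot_def id)
    ultimately show "(x, u, v) \<in> Tset \<alpha> c" unfolding Tset_def by blast
  qed
qed

lemma Tset_reflect [simp]: "reflect p \<in> Tset \<alpha> c \<longleftrightarrow> p \<in> Tset (flip \<alpha>) c"
proof (cases p)
  case (fields x u v)
  have "reflect p \<in> Tset \<alpha> c \<longleftrightarrow> (cos x * u + sin x * v, - (cos x * v - sin x * u)) \<in> Hset \<alpha> c"
    by (simp add: fields Tset_iff)
  then show ?thesis by (simp add: fields Tset_iff Hset_flip[of _ _ \<alpha>])
qed

lemma Tset_eq_reflect: "Tset (flip \<alpha>) c = reflect ` Tset \<alpha> c"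
proof (intro set_eqI iffI)
  fix p assume "p \<in> Tset (flip \<alpha>) c"
  then have "reflect (reflect p) \<in> reflect ` Tset \<alpha> c" by (intro imageI) simp
  then show "p \<in> reflect ` Tset \<alpha> c" by simp
next
  fix p assume "p \<in> reflect ` Tset \<alpha> c"
  then obtain q where "p = reflect q" "q \<in> Tset \<alpha> c" by blast
  then show "p \<in> Tset (flip \<alpha>) c" using Tset_reflect[of q "flip \<alpha>" c] by simp
qed

lemma modeq_reflect [simp]: "modeq (reflect p) (reflect q) \<longleftrightarrow> modeq p q"
proof -
  have "(\<exists>k::int. - a + b = 2 * pi * of_int k) \<longleftrightarrow> (\<exists>k::int. a - b = 2 * pi * of_int k)" for a b
  proof -
    have "(\<exists>k::int. - a + b = 2 * pi * of_int k) \<longleftrightarrow> (\<exists>k::int. - a + b = 2 * pi * of_int (- k))"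
      by (metis minus_minus)
    also have "\<dots> \<longleftrightarrow> (\<exists>k::int. a - b = 2 * pi * of_int k)" by (intro ex_cong1) auto
    finally show ?thesis .
  qed
  then show ?thesis by (cases p, cases q) (auto simp: modeq_def)
qed

lemma orbit_reflect: "orbit (reflect \<circ> \<gamma>) = reflect ` orbit \<gamma>"
proof -
  have "q \<in> orbit (reflect \<circ> \<gamma>) \<longleftrightarrow> reflect q \<in> orbit \<gamma>" for q
    using modeq_reflect[of _ "reflect q"] by (auto simp: orbit_def)
  then show ?thesis by (force simp: image_iff intro!: bexI[of _ "reflect _"])
qed

lemma periodic_sol_reflect [simp]: "periodic_sol (reflect \<circ> \<gamma>) \<longleftrightarrow> periodic_sol \<gamma>"
  by (simp add: periodic_sol_def)

lemma closure_reflect: "reflect ` closure S \<subseteq> closure (reflect ` S)"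
  by (intro image_closure_subset closed_closure closure_subset)
     (auto simp: reflect_def split_beta intro!: continuous_intros)

lemma all_periodic_iff: "all_periodic \<alpha> c \<longleftrightarrow> all_periodic Plus c"
proof (cases \<alpha>)
  case Minus
  have "all_periodic (flip \<alpha>) c" if "all_periodic \<alpha> c" for \<alpha>
    unfolding all_periodic_def
  proof (intro allI impI)
    fix \<gamma> assume "is_sol \<gamma>" "\<gamma> 0 \<in> Tset (flip \<alpha>) c"
    then have "is_sol (reflect \<circ> \<gamma>)" "(reflect \<circ> \<gamma>) 0 \<in> Tset \<alpha> c"
      using is_sol_reflect by auto
    then have "periodic_sol (reflect \<circ> \<gamma>)"
      using that unfolding all_periodic_def by blast
    then show "periodic_sol \<gamma>" by simp
  qed
  from this[of Plus] this[of Minus] show ?thesis using Minus by auto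
qed simp

lemma all_dense_flip: "all_dense \<alpha> c \<Longrightarrow> all_dense (flip \<alpha>) c"
  unfolding all_dense_def
proof (intro allI impI)
  fix \<gamma> assume *: "\<forall>\<gamma>. is_sol \<gamma> \<longrightarrow> \<gamma> 0 \<in> Tset \<alpha> c \<longrightarrow> Tset \<alpha> c \<subseteq> closure (orbit \<gamma>)"
    and g: "is_sol \<gamma>" "\<gamma> 0 \<in> Tset (flip \<alpha>) c"
  then have "Tset \<alpha> c \<subseteq> closure (orbit (reflect \<circ> \<gamma>))" using is_sol_reflect[OF g(1)] by auto
  then have "reflect ` Tset \<alpha> c \<subseteq> reflect ` closure (reflect ` orbit \<gamma>)" unfolding orbit_reflect by blast
  also have "\<dots> \<subseteq> closure (reflect ` reflect ` orbit \<gamma>)" by (rule closure_reflect)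
  finally show "Tset (flip \<alpha>) c \<subseteq> closure (orbit \<gamma>)" by (simp add: Tset_eq_reflect image_image)
qed

section \<open>Parametrisation of the levels\<close>

text \<open>Solves \<open>L - ln L = L exp (- m) - ln (L exp (- m))\<close>: equal energy at the two
  points of the level with \<open>u = 0\<close>. \<open>energy\<close> is \<open>H\<close>
  there.\<close>

definition peak_sq :: "real \<Rightarrow> real" where "peak_sq m = m / (1 - exp (- m))"

definition energy :: "real \<Rightarrow> real" where "energy m = (peak_sq m - ln (peak_sq m)) / 2"

lemma exp_gt_one_plus_self:
  fixes x :: real assumes "x \<noteq> 0" shows "1 + x < exp x"
proof (cases "1 + x / 2 \<ge> 0")
  case True
  have "(1 + x / 2)\<^sup>2 = 1 + x + x\<^sup>2 / 4" by (simp add: power2_eq_square algebra_simps)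
  then have "1 + x < (1 + x / 2)\<^sup>2" using assms by simp
  also have "\<dots> \<le> (exp (x / 2))\<^sup>2" using True by (intro power_mono exp_ge_add_one_self)
  also have "\<dots> = exp x" by (simp add: exp_double[symmetric])
  finally show ?thesis .
next
  case False
  then have "1 + x < 0" by simp
  then show ?thesis using exp_gt_zero[of x] by linarith
qed

lemma isCont_energy: "m > 0 \<Longrightarrow> isCont energy m"
  unfolding energy_def peak_sq_def by (intro continuous_intros) auto

text \<open>Intermediate value theorem between \<open>c - 1/2\<close> and
  \<open>4 * c\<close>.\<close>

lemma ex_energy:
  assumes "c > 1 / 2" obtains m where "m > 0" "energy m = c"
proof -
  \<comment> \<open>\<open>1 < peak_sq m < 1 + m\<close> for \<open>m > 0\<close>, hence
    \<open>energy m1 < (1 + m1) / 2 = c / 2 + 1 / 4 < c\<close>.\<close>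
  define m1 where "m1 = c - 1 / 2"
  have m1: "m1 > 0" using assms by (simp add: m1_def)
  have "energy m1 < c"
  proof -
    have "m1 < 1 * (exp m1 - 1)" using exp_gt_one_plus_self[of m1] m1 by simp
    then have "exp (- m1) * m1 < exp (- m1) * (exp m1 - 1)" by simp
    also have "\<dots> = 1 - exp (- m1)" by (simp add: right_diff_distrib exp_add[symmetric])
    finally have "peak_sq m1 < 1 + m1" using m1 by (simp add: peak_sq_def divide_simps algebra_simps)
    moreover have "peak_sq m1 > 1" using exp_gt_one_plus_self[of "- m1"] m1 by (simp add: peak_sq_def)
    then have "ln (peak_sq m1) > 0" by simp
    ultimately show ?thesis using assms by (simp add: energy_def m1_def)
  qed
  \<comment> \<open>With \<open>L = peak_sq (4 * c)\<close>:
    \<open>ln L \<le> L / 2 - 1 + ln 2 \<le> L / 2\<close>, so the energy is at least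
    \<open>L / 4 \<ge> c\<close>.\<close>
  moreover have "c \<le> energy (4 * c)"
  proof -
    have L: "peak_sq (4 * c) \<ge> 4 * c"
      using assms by (simp add: peak_sq_def divide_simps algebra_simps)
    then have "ln (peak_sq (4 * c) / 2) \<le> peak_sq (4 * c) / 2 - 1" using assms by (intro ln_le_minus_one) auto
    moreover have "ln (peak_sq (4 * c) / 2) = ln (peak_sq (4 * c)) - ln 2" using L assms by (simp add: ln_div)
    moreover have "ln 2 \<le> (1::real)" using ln_le_minus_one[of 2] by simp
    ultimately show ?thesis using L by (simp add: energy_def)
  qed
  ultimately have "\<exists>m. m1 \<le> m \<and> m \<le> 4 * c \<and> energy m = c"
    using m1 assms by (intro IVT) (auto simp: m1_def isCont_energy)
  then obtain m where "m1 \<le> m" "energy m = c" by blast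
  then show ?thesis using m1 by (intro that[of m]) auto
qed

definition v_param :: "real \<Rightarrow> real \<Rightarrow> real" where
  "v_param m f = sqrt (peak_sq m) * exp (- m * (sin f)\<^sup>2 / 2)"

text \<open>\<open>speed\<close> is \<open>df/dt\<close> along a solution; \<open>X\<close> then decreases at the rate \<open>1 / sqrt J\<close> in \<open>f\<close>,
  and \<open>(u, v)\<close> is \<open>pi\<close>-periodic in \<open>f\<close>.\<close>
definition speed :: "real \<Rightarrow> real \<Rightarrow> real" where
  "speed m f = v_param m f * sqrt (Jk 0 m ((sin f)\<^sup>2))"

text \<open>Forced by \<open>v' = u v\<close>: the derivative of \<open>v\<close> in
  \<open>f\<close> is \<open>- m sin f cos f v\<close>, and \<open>f' = speed\<close>.\<close>

definition u_param :: "real \<Rightarrow> real \<Rightarrow> real" where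
  "u_param m f = - m * (sin f * cos f) * speed m f"

context
  fixes m :: real assumes m: "m > 0"
begin

lemma peak_sq_pos: "peak_sq m > 0" and peak_sq_eq: "peak_sq m * (1 - exp (- m)) = m"
  using m by (auto simp: peak_sq_def)

lemma v_param_pos: "v_param m f > 0"
  using peak_sq_pos by (simp add: v_param_def)

lemma v_param_sq: "(v_param m f)\<^sup>2 = peak_sq m * exp (- m * (sin f)\<^sup>2)"
  using peak_sq_pos by (simp add: v_param_def power_mult_distrib exp_double[symmetric])

lemma J_pos: "Jk 0 m ((sin f)\<^sup>2) > 0"
  by (rule Jk_pos[OF sin_squared_in_01])

lemma speed_pos: "speed m f > 0"
  using v_param_pos J_pos by (simp add: speed_def)

lemma speed_sq: "(speed m f)\<^sup>2 = (v_param m f)\<^sup>2 * Jk 0 m ((sin f)\<^sup>2)"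
  using J_pos[of f] by (simp add: speed_def power_mult_distrib)

text \<open>Conservation of energy, \<open>u\<^sup>2 = 2 c - v\<^sup>2 + ln (v\<^sup>2)\<close>. It
  is \<open>Jk_eq\<close> times \<open>v\<^sup>2\<close>, where \<open>peak_sq_eq\<close> turns the
  coefficient of \<open>t\<close> into \<open>m\<close>.\<close>

lemma u_param_sq: "(u_param m f)\<^sup>2 = peak_sq m - (v_param m f)\<^sup>2 - m * (sin f)\<^sup>2"
proof -
  define t where "t = (sin f)\<^sup>2"
  have c: "(cos f)\<^sup>2 = 1 - t" by (simp add: t_def cos_squared_eq)
  have "(u_param m f)\<^sup>2 = (v_param m f)\<^sup>2 * (m\<^sup>2 * (t * (1 - t)) * Jk 0 m t)"
    unfolding u_param_def power_mult_distrib speed_sq c t_def[symmetric] by simp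
  also have "\<dots> = peak_sq m * exp (- m * t) * (exp (m * t) * (1 - (1 - exp (- m)) * t) - 1)"
    unfolding Jk_eq v_param_sq t_def ..
  also have "\<dots> = peak_sq m * (exp (- m * t) * exp (m * t)) - peak_sq m * (1 - exp (- m)) * t * (exp (- m * t) * exp (m * t))
      - peak_sq m * exp (- m * t)"
    by (simp add: algebra_simps)
  also have "\<dots> = peak_sq m - m * t - (v_param m f)\<^sup>2"
    unfolding peak_sq_eq v_param_sq t_def[symmetric] by (simp add: exp_add[symmetric])
  finally show ?thesis by (simp add: t_def)
qed

lemma ln_v_param_sq: "ln ((v_param m f)\<^sup>2) = ln (peak_sq m) - m * (sin f)\<^sup>2"
  unfolding v_param_sq using peak_sq_pos by (simp add: ln_mult)

lemma param_in_Hset: "(u_param m f, v_param m f) \<in> Hset Plus (energy m)"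
  using v_param_pos[of f] by (simp add: H_def u_param_sq ln_v_param_sq energy_def)

lemma v_param_DERIV: "(v_param m has_real_derivative - m * (sin f * cos f) * v_param m f) (at f)"
  unfolding v_param_def by (auto intro!: derivative_eq_intros)

text \<open>Existence suffices: the derivative of \<open>u\<close> is recovered from the conserved
  energy.\<close>

lemma speed_DERIV: obtains d where "(speed m has_real_derivative d) (at f)"
proof -
  have "\<exists>d. ((\<lambda>f. sqrt (Jk 0 m ((sin f)\<^sup>2))) has_real_derivative d) (at f)"
  proof -
    have "\<exists>d. ((\<lambda>f. Jk 0 m ((sin f)\<^sup>2)) has_real_derivative d) (at f)"
      unfolding Jk_def of_real_eq_id id_apply by (rule exI) (rule derivative_eq_intros refl | simp)+
    then show ?thesis using DERIV_chain2[where f = sqrt and g = "\<lambda>f. Jk 0 m ((sin f)\<^sup>2)" and x = f, OF DERIV_real_sqrt[OF J_pos[of f]]] by blast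
  qed
  then show ?thesis using that DERIV_mult[OF v_param_DERIV] unfolding speed_def by blast
qed

text \<open>Away from the turning points, differentiate \<open>u_param_sq\<close> and divide by
  \<open>u\<close>. Where \<open>u = 0\<close> this division fails and the derivative is computed
  directly.\<close>

lemma u_param_DERIV: "(u_param m has_real_derivative (1 - (v_param m f)\<^sup>2) / speed m f) (at f)"
proof -
  obtain s where s: "(speed m has_real_derivative s) (at f)" using speed_DERIV .
  define d where "d = - m * ((cos f)\<^sup>2 - (sin f)\<^sup>2) * speed m f - m * (sin f * cos f) * s"
  have d: "(u_param m has_real_derivative d) (at f)"
    unfolding u_param_def d_def
    by (auto intro!: derivative_eq_intros s simp: power2_eq_square algebra_simps)
  have "d * speed m f = 1 - (v_param m f)\<^sup>2"
  proof (cases "sin f * cos f = 0")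
    case False
    have "((\<lambda>f. (u_param m f)\<^sup>2) has_real_derivative 2 * u_param m f * d) (at f)"
      by (auto intro!: derivative_eq_intros d)
    moreover have "((\<lambda>f. (u_param m f)\<^sup>2) has_real_derivative
        - 2 * m * (sin f * cos f) * (1 - (v_param m f)\<^sup>2)) (at f)"
      unfolding u_param_sq
      by (auto intro!: derivative_eq_intros v_param_DERIV simp: power2_eq_square algebra_simps)
    ultimately have "2 * u_param m f * d = - 2 * m * (sin f * cos f) * (1 - (v_param m f)\<^sup>2)"
      by (rule DERIV_unique)
    then have "(m * (sin f * cos f)) * (d * speed m f) = (m * (sin f * cos f)) * (1 - (v_param m f)\<^sup>2)"
      by (simp add: u_param_def algebra_simps)
    with False m show ?thesis by simp
  next
    case True
    \<comment> \<open>The unknown \<open>s\<close> drops out, being multiplied by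
      \<open>sin f cos f = 0\<close>. \<open>Jk 0 m\<close> reduces to \<open>phi 0 (- m)\<close> at
      \<open>t = 0\<close> and to \<open>phi 0 m\<close> at \<open>t = 1\<close>, which
      \<open>phi_0_eq\<close> evaluates.\<close>
    have ds: "d * speed m f = - m * ((cos f)\<^sup>2 - (sin f)\<^sup>2) * ((v_param m f)\<^sup>2 * Jk 0 m ((sin f)\<^sup>2))"
      unfolding speed_sq[symmetric] d_def True by (simp add: power2_eq_square)
    from True consider "sin f = 0" | "cos f = 0" by auto
    then show ?thesis
    proof cases
      case 1
      then have c: "(cos f)\<^sup>2 = 1" by (simp add: cos_squared_eq)
      have "m * (d * speed m f) = - peak_sq m * (m\<^sup>2 * phi 0 (- m))"
        unfolding ds c v_param_sq by (simp add: 1 Jk_def power2_eq_square)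
      also have "m\<^sup>2 * phi 0 (- m) = exp (- m) - 1 + m" using phi_0_eq[of "- m"] by simp
      also have "- peak_sq m * (exp (- m) - 1 + m) = peak_sq m * (1 - exp (- m)) - m * peak_sq m"
        by (simp add: algebra_simps)
      also have "\<dots> = m * (1 - (v_param m f)\<^sup>2)"
        unfolding peak_sq_eq v_param_sq by (simp add: 1 algebra_simps)
      finally show ?thesis using m by simp
    next
      case 2
      then have c: "(sin f)\<^sup>2 = 1" by (simp add: sin_squared_eq)
      have "m * (d * speed m f) = peak_sq m * exp (- m) * (m\<^sup>2 * phi 0 m)"
        unfolding ds c v_param_sq by (simp add: 2 Jk_def power2_eq_square)
      also have "\<dots> = peak_sq m * (exp (- m) * exp m) - peak_sq m * exp (- m) - m * (peak_sq m * exp (- m))"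
        unfolding phi_0_eq by (simp add: algebra_simps)
      also have "\<dots> = peak_sq m * (1 - exp (- m)) - m * (peak_sq m * exp (- m))"
        by (simp add: exp_add[symmetric] algebra_simps)
      also have "\<dots> = m * (1 - (v_param m f)\<^sup>2)"
        unfolding peak_sq_eq v_param_sq c by (simp add: algebra_simps)
      finally show ?thesis using m by simp
    qed
  qed
  then have "d = (1 - (v_param m f)\<^sup>2) / speed m f" using speed_pos[of f] by (simp add: field_simps)
  with d show ?thesis by simp
qed

lemma sin_cos_shift:
  "sin (f + of_int n * pi) = (if even n then 1 else - 1) * sin f"
  "cos (f + of_int n * pi) = (if even n then 1 else - 1) * cos f"
  by (simp_all add: sin_add cos_add mult.commute[of _ pi] sin_npi_int cos_npi_int)

lemma param_shift:
  "(sin (f + of_int n * pi))\<^sup>2 = (sin f)\<^sup>2"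
  "v_param m (f + of_int n * pi) = v_param m f" "speed m (f + of_int n * pi) = speed m f"
  "u_param m (f + of_int n * pi) = u_param m f"
proof -
  show 1: "(sin (f + of_int n * pi))\<^sup>2 = (sin f)\<^sup>2"
    by (simp add: sin_cos_shift)
  have 2: "sin (f + of_int n * pi) * cos (f + of_int n * pi) = sin f * cos f"
    by (simp add: sin_cos_shift)
  show 3: "v_param m (f + of_int n * pi) = v_param m f" unfolding v_param_def 1 ..
  show 4: "speed m (f + of_int n * pi) = speed m f" unfolding speed_def 1 3 ..
  show "u_param m (f + of_int n * pi) = u_param m f" unfolding u_param_def 2 4 ..
qed

text \<open>\<open>v\<close> determines \<open>(sin f)^2\<close> and thereby \<open>speed\<close>;
  then \<open>u\<close> determines \<open>sin f cos f\<close>. Together they fix \<open>2 f\<close>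
  modulo \<open>2 pi\<close>.\<close>

lemma param_inj:
  assumes "u_param m f = u_param m g" "v_param m f = v_param m g"
  obtains n :: int where "f = g + of_int n * pi"
proof -
  have "exp (- m * (sin f)\<^sup>2) = exp (- m * (sin g)\<^sup>2)"
    using v_param_sq[of f] v_param_sq[of g] peak_sq_pos assms(2) by (metis less_irrefl mult_left_cancel)
  then have s: "(sin f)\<^sup>2 = (sin g)\<^sup>2" using m by auto
  have "speed m f = speed m g" unfolding speed_def s assms(2) ..
  then have sc: "sin f * cos f = sin g * cos g"
    using assms(1) m speed_pos[of g] unfolding u_param_def by simp
  have "sin (2 * f) = sin (2 * g)" using sc by (simp add: sin_double)
  moreover have "cos (2 * f) = cos (2 * g)" using s by (simp add: cos_double_sin)
  ultimately obtain n :: int where "2 * f = 2 * g + 2 * pi * of_int n"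
    using sin_cos_eq_iff by blast
  then show ?thesis using that[of n] by (simp add: algebra_simps)
qed

text \<open>\<open>v\<close> dictates \<open>t\<close>; the point is to show
  \<open>0 \<le> t \<le> 1\<close>, so that \<open>t\<close> is a squared sine.\<close>

lemma param_surj:
  assumes "(u, v) \<in> Hset Plus (energy m)"
  obtains f where "u = u_param m f" "v = v_param m f"
proof -
  have v: "v > 0" and H: "u\<^sup>2 + v\<^sup>2 - ln (v\<^sup>2) = peak_sq m - ln (peak_sq m)"
    using assms by (auto simp: H_def energy_def split: if_splits)
  define t where "t = (ln (peak_sq m) - ln (v\<^sup>2)) / m"
  have mt: "m * t = ln (peak_sq m) - ln (v\<^sup>2)" using m by (simp add: t_def)
  have "peak_sq m * exp (- m * t) = exp (ln (peak_sq m)) * exp (- (m * t))" using peak_sq_pos by simp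
  also have "\<dots> = exp (ln (v\<^sup>2))" unfolding exp_add[symmetric] mt by simp
  finally have v2: "v\<^sup>2 = peak_sq m * exp (- m * t)" using v by simp
  have u2: "u\<^sup>2 = peak_sq m - v\<^sup>2 - m * t" using H mt by simp
  also have "\<dots> = peak_sq m * (1 - (1 - exp (- m)) * t - exp (- m * t))"
    unfolding v2 by (subst peak_sq_eq[symmetric]) (simp add: algebra_simps)
  finally have "0 \<le> peak_sq m * (1 - (1 - exp (- m)) * t - exp (- m * t))" by (metis zero_le_power2)
  \<comment> \<open>The convex function \<open>exp (- m * t)\<close> is at most its chord over
    \<open>[0, 1]\<close>, which forces \<open>t\<close> into that interval; the two cases below
    compare with its tangents at \<open>0\<close> and at \<open>1\<close>.\<close>
  then have q: "exp (- m * t) \<le> 1 - (1 - exp (- m)) * t"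
    using peak_sq_pos by (simp add: zero_le_mult_iff)
  have t0: "t \<ge> 0"
  proof (rule ccontr)
    assume "\<not> t \<ge> 0"
    then have t: "t < 0" by simp
    have "1 - exp (- m) < m" using exp_gt_one_plus_self[of "- m"] m by simp
    then have "(- t) * (1 - exp (- m)) < (- t) * m" using t by (intro mult_strict_left_mono) auto
    moreover have "1 + (- m * t) \<le> exp (- m * t)" by (rule exp_ge_add_one_self)
    ultimately show False using q by (simp add: algebra_simps)
  qed
  have t1: "t \<le> 1"
  proof (rule ccontr)
    assume "\<not> t \<le> 1"
    then have t: "t - 1 > 0" by simp
    have "1 + m < exp m" using exp_gt_one_plus_self[of m] m by simp
    then have "exp (- m) * (1 + m) < exp (- m) * exp m" by (intro mult_strict_left_mono) auto
    also have "\<dots> = 1" by (simp add: exp_add[symmetric])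
    finally have "exp (- m) * m < 1 - exp (- m)" by (simp add: algebra_simps)
    then have "(t - 1) * (exp (- m) * m) < (t - 1) * (1 - exp (- m))" using t by (intro mult_strict_left_mono)
    moreover have "exp (- m) * (1 + (- m * (t - 1))) \<le> exp (- m) * exp (- m * (t - 1))"
      by (intro mult_left_mono exp_ge_add_one_self) auto
    moreover have "exp (- m) * exp (- m * (t - 1)) = exp (- m * t)"
      unfolding exp_add[symmetric] by (simp add: algebra_simps)
    ultimately show False using q by (simp add: algebra_simps)
  qed
  \<comment> \<open>\<open>f\<close> and \<open>- f\<close> have the same \<open>v\<close> and
    opposite \<open>u\<close>, which settles the sign of \<open>u\<close>.\<close>
  define f where "f = arcsin (sqrt t)"
  have "- 1 \<le> sqrt t" using real_sqrt_ge_zero[OF t0] by linarith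
  then have "sin f = sqrt t" using t1 by (simp add: f_def)
  then have s: "(sin f)\<^sup>2 = t" using t0 by simp
  have "(v_param m f)\<^sup>2 = v\<^sup>2" unfolding v_param_sq s v2 ..
  then have v_param: "v_param m f = v" using v_param_pos[of f] v by (simp add: power2_eq_iff_nonneg)
  have vf': "v_param m (- f) = v" using v_param unfolding v_param_def by simp
  have "(u_param m f)\<^sup>2 = u\<^sup>2" unfolding u_param_sq v_param s u2 ..
  then consider "u = u_param m f" | "u = - u_param m f" by (auto simp: power2_eq_iff)
  then show ?thesis
  proof cases
    case 1 then show ?thesis using that[of f] v_param by simp
  next
    case 2
    then have "u = u_param m (- f)" by (simp add: u_param_def speed_def v_param_def)
    then show ?thesis using that[of "- f"] vf' by simp
  qed
qed

section \<open>Explicit solutions on a level\<close>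

lemma is_sol_param:
  assumes X: "\<And>t. (X has_real_derivative - v_param m (f t)) (at t)"
    and f: "\<And>t. (f has_real_derivative speed m (f t)) (at t)"
  shows "is_sol (\<lambda>t. (X t, rot (X t) (u_param m (f t), v_param m (f t))))"
proof -
  have u: "((\<lambda>t. u_param m (f t)) has_real_derivative 1 - (v_param m (f t))\<^sup>2) (at t)" for t
    using DERIV_chain2[OF u_param_DERIV f, of t] speed_pos[of "f t"] by simp
  have v: "((\<lambda>t. v_param m (f t)) has_real_derivative u_param m (f t) * v_param m (f t)) (at t)" for t
    using DERIV_chain2[OF v_param_DERIV f, of t] by (simp add: u_param_def mult_ac)
  have sc: "(sin x)\<^sup>2 = 1 - (cos x)\<^sup>2" for x :: real by (simp add: sin_squared_eq)
  show ?thesis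
    unfolding rot_def split is_sol_iff
  proof (intro allI conjI)
    fix t
    have "sin x * (cos x * a - sin x * b) - cos x * (sin x * a + cos x * b) = - b" for x a b :: real
      using sin_cos_squared_add[of x] by algebra
    then show "(X has_real_derivative
          sin (X t) * (cos (X t) * u_param m (f t) - sin (X t) * v_param m (f t)) -
          cos (X t) * (sin (X t) * u_param m (f t) + cos (X t) * v_param m (f t))) (at t)"
      using X[of t] by simp
    show "((\<lambda>t. cos (X t) * u_param m (f t) - sin (X t) * v_param m (f t)) has_real_derivative cos (X t)) (at t)"
      by (auto intro!: derivative_eq_intros u v X simp: power2_eq_square algebra_simps)
    show "((\<lambda>t. sin (X t) * u_param m (f t) + cos (X t) * v_param m (f t)) has_real_derivative sin (X t)) (at t)"
      by (auto intro!: derivative_eq_intros u v X simp: power2_eq_square algebra_simps)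
  qed
qed

lemma continuous_on_v_param: "continuous_on S (v_param m)"
  using v_param_DERIV DERIV_isCont continuous_at_imp_continuous_on by blast

lemma continuous_on_speed: "continuous_on S (speed m)"
  using speed_DERIV DERIV_isCont continuous_at_imp_continuous_on by metis

lemma reduce_mod_pi: obtains n :: int where "f + of_int n * pi \<in> {0..pi}"
proof
  have "f / pi - of_int \<lfloor>f / pi\<rfloor> \<in> {0..1}" by (auto simp: algebra_simps) linarith
  then have "pi * (f / pi - of_int \<lfloor>f / pi\<rfloor>) \<in> {0..pi}" by (auto simp: mult_left_le)
  then show "f + of_int (- \<lfloor>f / pi\<rfloor>) * pi \<in> {0..pi}" by (simp add: algebra_simps)
qed

text \<open>Compactness on one period; this is the lower bound that makes the time function globally
  invertible.\<close>

lemma speed_upper: obtains b where "b > 0" "\<And>f. inverse (speed m f) \<ge> b"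
proof -
  have "bounded (speed m ` {0..pi})"
    by (intro compact_imp_bounded compact_continuous_image continuous_on_speed) auto
  then obtain B where B: "\<forall>y \<in> speed m ` {0..pi}. norm y \<le> B" unfolding bounded_iff by blast
  have le: "speed m f \<le> B" for f
  proof -
    obtain n :: int where "f + of_int n * pi \<in> {0..pi}" by (rule reduce_mod_pi)
    then have "norm (speed m (f + of_int n * pi)) \<le> B" using B by blast
    then show ?thesis by (simp add: param_shift)
  qed
  then have "B > 0" using speed_pos[of 0] le[of 0] by linarith
  with le speed_pos show ?thesis using that[of "inverse B"] by (auto intro!: le_imp_inverse_le)
qed

text \<open>\<open>S\<close> is the angle swept and \<open>G\<close> the time elapsed, both as
  functions of the phase, and \<open>f\<close> inverts \<open>G\<close>. One turn adds
  \<open>turning m\<close> to \<open>S\<close> and the period of \<open>(u, v)\<close> to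
  \<open>G\<close>.\<close>

lemma explicit_solutions:
  obtains S G f where
    "\<And>y n. S (y + of_int n * pi) = S y + of_int n * turning m"
    "\<And>y n. G (y + of_int n * pi) = G y + of_int n * (G pi - G 0)" "G pi - G 0 > 0"
    "\<And>y. f (G y) = y" "\<And>t. G (f t) = t" "strict_mono f"
    "\<And>x t0. is_sol (\<lambda>t. (x - S (f (t0 + t)),
      rot (x - S (f (t0 + t))) (u_param m (f (t0 + t)), v_param m (f (t0 + t)))))"
proof -
  define s where "s y = inverse (sqrt (Jk 0 m ((sin y)\<^sup>2)))" for y
  have s_eq: "s y = v_param m y * inverse (speed m y)" for y
    using v_param_pos[of y] by (simp add: s_def speed_def)
  have s_cont: "continuous_on A s" for A
    unfolding s_eq using speed_pos by (intro continuous_intros continuous_on_v_param continuous_on_speed) (auto simp: less_le)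
  obtain S where S: "\<And>y. (S has_real_derivative s y) (at y)"
    using ex_antiderivative[OF s_cont] by blast
  have "(s has_integral S pi - S 0) {0..pi}"
    using S by (intro fundamental_theorem_of_calculus)
      (auto simp: has_real_derivative_iff_has_vector_derivative[symmetric] intro: has_field_derivative_at_within)
  then have T: "S pi - S 0 = turning m" unfolding turning_def s_def[symmetric] by (simp add: integral_unique)
  have s_per: "s (y + pi) = s y" for y using param_shift(1)[of y 1] by (simp add: s_def)
  have "continuous_on UNIV (\<lambda>y. inverse (speed m y))"
    using speed_pos by (intro continuous_intros continuous_on_speed) (auto simp: less_le)
  then obtain G where G: "\<And>y. (G has_real_derivative inverse (speed m y)) (at y)"
    using ex_antiderivative by blast
  have G_per: "inverse (speed m (y + pi)) = inverse (speed m y)" for y using param_shift(3)[of y 1] by simp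
  obtain b where "b > 0" "\<And>f. inverse (speed m f) \<ge> b" using speed_upper by blast
  then obtain f where f: "\<And>x. f (G x) = x" "\<And>t. G (f t) = t"
    "\<And>t. (f has_real_derivative inverse (inverse (speed m (f t)))) (at t)"
    using ex_inverse_of_antiderivative[OF G] by metis
  have Gmono: "G x < G y" if "x < y" for x y
    by (rule DERIV_pos_imp_increasing[OF that]) (use G speed_pos in \<open>auto intro!: exI\<close>)
  have fmono: "strict_mono f"
  proof (rule strict_monoI)
    fix x y :: real assume "x < y"
    then show "f x < f y"
      by (rule DERIV_pos_imp_increasing) (use f(3) speed_pos in \<open>auto intro!: exI\<close>)
  qed
  have sol: "is_sol (\<lambda>t. (x - S (f (t0 + t)), rot (x - S (f (t0 + t))) (u_param m (f (t0 + t)), v_param m (f (t0 + t)))))" for x t0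
  proof (rule is_sol_param)
    fix t
    show f': "((\<lambda>t. f (t0 + t)) has_real_derivative speed m (f (t0 + t))) (at t)" for t
      using f(3)[of "t0 + t"] DERIV_shift[of f "speed m (f (t0 + t))" t t0] by (simp add: add.commute)
    show "((\<lambda>t. x - S (f (t0 + t))) has_real_derivative - v_param m (f (t0 + t))) (at t)"
      using speed_pos[of "f (t0 + t)"]
      by (auto intro!: derivative_eq_intros DERIV_chain2[OF S] f' simp: s_eq)
  qed
  show ?thesis
    using that[OF _ _ _ f(1,2) fmono sol] antiderivative_periodic_shift[of S s pi, OF S s_per]
      antiderivative_periodic_shift[of G "\<lambda>y. inverse (speed m y)" pi, OF G G_per] Gmono[of 0 pi] T
    by simp
qed

end

section \<open>Periodic and dense orbits\<close>

text \<open>\<open>x\<close> is an offset and \<open>s\<close> a time shift; the initial angle is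
  \<open>x - S (f s)\<close>.\<close>

definition curve :: "real \<Rightarrow> (real \<Rightarrow> real) \<Rightarrow> (real \<Rightarrow> real) \<Rightarrow> real \<Rightarrow> real \<Rightarrow> real \<Rightarrow> real \<times> real \<times> real" where
  "curve m S f x s t = (x - S (f (s + t)), rot (x - S (f (s + t))) (u_param m (f (s + t)), v_param m (f (s + t))))"

text \<open>For a point of angle \<open>x\<close> and phase \<open>y\<close>, the time shift
  \<open>G y\<close> and the offset \<open>x + S y\<close> give a curve through it; uniqueness makes
  every solution on the level such a curve.\<close>

lemma level_solutions:
  assumes m: "m > 0"
  obtains S G f where
    "\<And>y n. S (y + of_int n * pi) = S y + of_int n * turning m"
    "\<And>y n. G (y + of_int n * pi) = G y + of_int n * (G pi - G 0)" "G pi - G 0 > 0"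
    "\<And>y. f (G y) = y" "\<And>t. G (f t) = t" "strict_mono f"
    "\<And>p. p \<in> Tset Plus (energy m) \<Longrightarrow> \<exists>x s. is_sol (curve m S f x s) \<and> curve m S f x s 0 = p"
    "\<And>\<gamma>. is_sol \<gamma> \<Longrightarrow> \<gamma> 0 \<in> Tset Plus (energy m) \<Longrightarrow> \<exists>x s. \<gamma> = curve m S f x s"
proof (rule explicit_solutions[OF m])
  fix S G f
  assume SG: "\<And>y n. S (y + of_int n * pi) = S y + of_int n * turning m"
    "\<And>y n. G (y + of_int n * pi) = G y + of_int n * (G pi - G 0)" "G pi - G 0 > 0"
    "\<And>y. f (G y) = y" "\<And>t. G (f t) = t" "strict_mono f"
    and sol: "\<And>x t0. is_sol (\<lambda>t. (x - S (f (t0 + t)),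
      rot (x - S (f (t0 + t))) (u_param m (f (t0 + t)), v_param m (f (t0 + t)))))"
  have sol': "is_sol (curve m S f x s)" for x s
    using sol[of x s] by (simp add: curve_def[abs_def])
  have ex: "\<exists>x s. is_sol (curve m S f x s) \<and> curve m S f x s 0 = p" if p: "p \<in> Tset Plus (energy m)" for p
  proof -
    obtain x z where z: "p = (x, rot x z)" "z \<in> Hset Plus (energy m)" using p by (auto simp: Tset_def)
    obtain y where y: "fst z = u_param m y" "snd z = v_param m y"
      using param_surj[OF m, of "fst z" "snd z"] z(2) by auto
    then have "z = (u_param m y, v_param m y)" by (simp add: prod_eq_iff)
    then have "curve m S f (x + S y) (G y) 0 = p" by (simp add: curve_def SG(4) z(1))
    then show ?thesis using sol' by blast
  qed
  have un: "\<exists>x s. \<gamma> = curve m S f x s" if "is_sol \<gamma>" "\<gamma> 0 \<in> Tset Plus (energy m)" for \<gamma>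
    using ex[OF that(2)] sol_unique[OF that(1)] by metis
  show ?thesis by (rule that[OF SG ex un])
qed

lemma rot_add_2pi: "rot (x + 2 * pi * of_int k) z = rot x z"
  using sin_cos_eq_iff[of "x + 2 * pi * of_int k" x] by (simp add: rot_def split: prod.splits)

lemma rot_inj: "rot x z = rot x w \<Longrightarrow> z = w"
proof (cases z, cases w)
  fix a b c d assume "rot x z = rot x w" and zw: "z = (a, b)" "w = (c, d)"
  then have e: "cos x * a - sin x * b = cos x * c - sin x * d" "sin x * a + cos x * b = sin x * c + cos x * d"
    by (auto simp: rot_def)
  have "a = c" "b = d" using e sin_cos_squared_add[of x] by algebra+
  then show "z = w" by (simp add: zw)
qed

lemma level_nonempty:
  assumes "m > 0" shows "Tset Plus (energy m) \<noteq> {}"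
proof -
  have "(0, rot 0 (u_param m 0, v_param m 0)) \<in> Tset Plus (energy m)"
    unfolding Tset_def using param_in_Hset[OF assms] by blast
  then show ?thesis by blast
qed

lemma invariant_level:
  assumes m: "m > 0" shows "invariant (Tset Plus (energy m))"
  unfolding invariant_def
proof (intro allI impI)
  fix \<gamma> t assume g: "is_sol \<gamma>" "\<gamma> 0 \<in> Tset Plus (energy m)"
  obtain S f x s where "\<gamma> = curve m S f x s" by (rule level_solutions[OF m]) (use g in blast)
  then show "\<gamma> t \<in> Tset Plus (energy m)"
    using param_in_Hset[OF m] by (auto simp: Tset_def curve_def)
qed

text \<open>If the quotient is \<open>k / n\<close>, then after \<open>n\<close> turns
  \<open>(u, v)\<close> has returned and \<open>X\<close> has changed by
  \<open>- 2 pi k\<close>.\<close>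

lemma all_periodic_if_rational:
  assumes m: "m > 0" and T: "turning m / (2 * pi) \<in> \<rat>" shows "all_periodic Plus (energy m)"
  unfolding all_periodic_def
proof (intro allI impI)
  fix \<gamma> assume g: "is_sol \<gamma>" "\<gamma> 0 \<in> Tset Plus (energy m)"
  obtain k n :: int where n: "n > 0" and kn: "turning m / (2 * pi) = of_int k / of_int n"
    using T by (metis Rats_cases')
  then have T': "of_int n * turning m = 2 * pi * of_int k" by (simp add: field_simps)
  show "periodic_sol \<gamma>"
  proof (rule level_solutions[OF m])
    fix S G f
    assume S: "\<And>y n. S (y + of_int n * pi) = S y + of_int n * turning m"
      and G: "\<And>y n. G (y + of_int n * pi) = G y + of_int n * (G pi - G 0)" "G pi - G 0 > 0"
      and f: "\<And>y. f (G y) = y" "\<And>t. G (f t) = t"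
      and ex: "\<And>\<gamma>. is_sol \<gamma> \<Longrightarrow> \<gamma> 0 \<in> Tset Plus (energy m) \<Longrightarrow> \<exists>x s. \<gamma> = curve m S f x s"
    obtain x s where c: "\<gamma> = curve m S f x s" using ex[OF g] by blast
    define P where "P = of_int n * (G pi - G 0)"
    have P: "f (t + P) = f t + of_int n * pi" for t
      using f(1)[of "f t + of_int n * pi"] unfolding G(1) f(2) P_def .
    have "modeq (\<gamma> (t + P)) (\<gamma> t)" for t
    proof -
      have "\<gamma> (t + P) = (x - S (f (s + t)) - 2 * pi * of_int k,
          rot (x - S (f (s + t)) - 2 * pi * of_int k) (u_param m (f (s + t)), v_param m (f (s + t))))"
        using P[of "s + t"] by (simp add: c curve_def add.assoc S T' param_shift[OF m] diff_diff_eq)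
      also have "rot (x - S (f (s + t)) - 2 * pi * of_int k) z = rot (x - S (f (s + t))) z" for z
        using rot_add_2pi[of "x - S (f (s + t))" "- k"] by simp
      finally have "\<gamma> (t + P) = (x - S (f (s + t)) - 2 * pi * of_int k, snd (\<gamma> t))"
        by (simp add: c curve_def)
      then show ?thesis unfolding modeq_def by (auto simp: c curve_def intro!: exI[of _ "- k"])
    qed
    moreover have "P > 0" using G(2) n by (simp add: P_def)
    ultimately show "periodic_sol \<gamma>" unfolding periodic_sol_def by blast
  qed
qed

text \<open>A single return is enough: equal points force equal \<open>(u, v)\<close>, so the phase
  has advanced by \<open>n pi\<close>, with \<open>n \<noteq> 0\<close> because \<open>f\<close> is
  strictly increasing. Comparing angles puts \<open>n * turning m\<close> in \<open>2 pi\<close>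
  times the integers.\<close>

lemma rational_if_periodic:
  assumes m: "m > 0" and g: "is_sol \<gamma>" "\<gamma> 0 \<in> Tset Plus (energy m)" and per: "periodic_sol \<gamma>"
  shows "turning m / (2 * pi) \<in> \<rat>"
proof (rule level_solutions[OF m])
  fix S G f
  assume S: "\<And>y n. S (y + of_int n * pi) = S y + of_int n * turning m"
    and f: "strict_mono f"
    and ex: "\<And>\<gamma>. is_sol \<gamma> \<Longrightarrow> \<gamma> 0 \<in> Tset Plus (energy m) \<Longrightarrow> \<exists>x s. \<gamma> = curve m S f x s"
  obtain x s where c: "\<gamma> = curve m S f x s" using ex[OF g] by blast
  obtain P where P: "P > 0" "modeq (\<gamma> (0 + P)) (\<gamma> 0)" using per unfolding periodic_sol_def by blast
  then obtain k :: int where k: "(x - S (f (s + P))) - (x - S (f s)) = 2 * pi * of_int k"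
    and eq: "rot (x - S (f (s + P))) (u_param m (f (s + P)), v_param m (f (s + P))) = rot (x - S (f s)) (u_param m (f s), v_param m (f s))"
    by (auto simp: modeq_def c curve_def)
  have "x - S (f (s + P)) = x - S (f s) + 2 * pi * of_int k" using k by simp
  with eq have "(u_param m (f (s + P)), v_param m (f (s + P))) = (u_param m (f s), v_param m (f s))"
    by (metis rot_add_2pi rot_inj)
  then obtain n :: int where n: "f (s + P) = f s + of_int n * pi" using param_inj[OF m] by blast
  have "f s < f (s + P)" using f P(1) by (simp add: strict_mono_less)
  then have "n \<noteq> 0" using n by auto
  have "of_int n * turning m = 2 * pi * of_int (- k)" using k unfolding n S by simp
  then have "turning m / (2 * pi) = of_int (- k) / of_int n" using \<open>n \<noteq> 0\<close> by (simp add: field_simps)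
  then show ?thesis by (metis Rats_divide Rats_of_int)
qed

text \<open>Nonemptiness of the level and existence of a solution on it keep
  \<open>all_periodic\<close> from holding vacuously.\<close>

lemma all_periodic_level_iff:
  assumes m: "m > 0" shows "all_periodic Plus (energy m) \<longleftrightarrow> turning m / (2 * pi) \<in> \<rat>"
proof
  assume ap: "all_periodic Plus (energy m)"
  obtain p where p: "p \<in> Tset Plus (energy m)" using level_nonempty[OF m] by blast
  have "\<exists>\<gamma>. is_sol \<gamma> \<and> \<gamma> 0 = p" by (rule level_solutions[OF m]) (use p in blast)
  then obtain \<gamma> where "is_sol \<gamma>" "\<gamma> 0 \<in> Tset Plus (energy m)" using p by blast
  then show "turning m / (2 * pi) \<in> \<rat>"
    using ap rational_if_periodic[OF m] unfolding all_periodic_def by blast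
qed (rule all_periodic_if_rational[OF m])

text \<open>Fix the phase \<open>a\<close> of the target. The saturated orbit meets this phase
  exactly along an irrational rotation of the angle, so its angles come arbitrarily close to that of
  the target.\<close>

lemma all_dense_if_irrational:
  assumes m: "m > 0" and T: "turning m / (2 * pi) \<notin> \<rat>" shows "all_dense Plus (energy m)"
  unfolding all_dense_def
proof (intro allI impI subsetI)
  fix \<gamma> q assume g: "is_sol \<gamma>" "\<gamma> 0 \<in> Tset Plus (energy m)" and q: "q \<in> Tset Plus (energy m)"
  obtain y w where "q = (y, rot y w)" "w \<in> Hset Plus (energy m)" using q by (auto simp: Tset_def)
  moreover obtain a where "fst w = u_param m a" "snd w = v_param m a"
    using param_surj[OF m, of "fst w" "snd w"] calculation(2) by auto
  ultimately have qy: "q = (y, rot y (u_param m a, v_param m a))" by (metis prod.collapse)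
  show "q \<in> closure (orbit \<gamma>)"
  proof (rule level_solutions[OF m])
    fix S G f
    assume S: "\<And>y n. S (y + of_int n * pi) = S y + of_int n * turning m"
      and f: "\<And>y. f (G y) = y"
      and ex: "\<And>\<gamma>. is_sol \<gamma> \<Longrightarrow> \<gamma> 0 \<in> Tset Plus (energy m) \<Longrightarrow> \<exists>x s. \<gamma> = curve m S f x s"
    obtain x s where c: "\<gamma> = curve m S f x s" using ex[OF g] by blast
    have orb: "(x - S a - of_int n * turning m + 2 * pi * of_int h,
        rot (x - S a - of_int n * turning m + 2 * pi * of_int h) (u_param m a, v_param m a)) \<in> orbit \<gamma>" for n h :: int
    proof -
      have "\<gamma> (G (a + of_int n * pi) - s) = (x - S a - of_int n * turning m,
          rot (x - S a - of_int n * turning m) (u_param m a, v_param m a))"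
        by (simp add: c curve_def f S param_shift[OF m] diff_diff_eq)
      then show ?thesis
        unfolding orbit_def modeq_def
        by (auto simp: rot_add_2pi intro!: exI[of _ "G (a + of_int n * pi) - s"] exI[of _ "- h"])
    qed
    show ?thesis
      unfolding closure_approachable
    proof (intro allI impI)
      fix e :: real assume e: "e > 0"
      have "continuous (at y) (\<lambda>y. (y, rot y (u_param m a, v_param m a)))"
        unfolding rot_def by (auto intro!: continuous_intros)
      then obtain d where d: "d > 0"
        "\<And>y'. dist y' y < d \<Longrightarrow> dist (y', rot y' (u_param m a, v_param m a)) (y, rot y (u_param m a, v_param m a)) < e"
        using e unfolding continuous_at_eps_delta by metis
      \<comment> \<open>Density of integer multiples modulo \<open>1\<close>, in units of
        \<open>2 pi\<close>; negative \<open>n\<close> correspond to turns backwards in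
        time.\<close>
      obtain h n :: int where "\<bar>of_int n * (turning m / (2 * pi)) - of_int h - (x - S a - y) / (2 * pi)\<bar> < d / (2 * pi)"
        using sequence_of_fractional_parts_is_dense[OF T, of "d / (2 * pi)"] d(1) by (metis divide_pos_pos pi_gt_zero zero_less_mult_iff zero_less_numeral)
      then have "2 * pi * \<bar>of_int n * (turning m / (2 * pi)) - of_int h - (x - S a - y) / (2 * pi)\<bar> < d"
        by (simp add: field_simps)
      also have "2 * pi * \<bar>of_int n * (turning m / (2 * pi)) - of_int h - (x - S a - y) / (2 * pi)\<bar>
          = \<bar>2 * pi * (of_int n * (turning m / (2 * pi)) - of_int h - (x - S a - y) / (2 * pi))\<bar>"
        by (simp add: abs_mult)
      also have "2 * pi * (of_int n * (turning m / (2 * pi)) - of_int h - (x - S a - y) / (2 * pi))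
          = y - (x - S a - of_int n * turning m + 2 * pi * of_int h)"
        by (simp add: field_simps)
      finally have "dist (x - S a - of_int n * turning m + 2 * pi * of_int h) y < d"
        by (simp add: dist_real_def abs_minus_commute)
      from d(2)[OF this] orb show "\<exists>p \<in> orbit \<gamma>. dist p q < e" unfolding qy by blast
    qed
  qed
qed

section \<open>Countability and density of the periodic levels\<close>

lemma countable_all_periodic: "countable {c. c > 1 / 2 \<and> all_periodic Plus c}"
proof (rule countable_subset)
  show "{c. c > 1 / 2 \<and> all_periodic Plus c} \<subseteq> energy ` (\<Union>r \<in> \<rat>. {m. turning m = 2 * pi * r})"
  proof (clarify)
    fix c :: real assume "c > 1 / 2" "all_periodic Plus c"
    then obtain m where m: "m > 0" "energy m = c" using ex_energy by blast
    then have "turning m / (2 * pi) \<in> \<rat>" using \<open>all_periodic Plus c\<close> all_periodic_level_iff by blast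
    moreover have "turning m = 2 * pi * (turning m / (2 * pi))" by simp
    ultimately show "c \<in> energy ` (\<Union>r \<in> \<rat>. {m. turning m = 2 * pi * r})" using m(2) by blast
  qed
  show "countable (energy ` (\<Union>r \<in> \<rat>. {m. turning m = 2 * pi * r}))"
    by (intro countable_image countable_UN countable_rat countable_turning_level)
qed

text \<open>An interval is uncountable and a level set of \<open>turning\<close> countable, so two
  values occur, and with them a rational multiple of \<open>2 pi\<close> in between.\<close>

lemma ex_rational_turning:
  assumes "a < b" obtains m where "a < m" "m < b" "turning m / (2 * pi) \<in> \<rat>"
proof -
  have "\<not> {a<..<b} \<subseteq> {m. turning m = turning ((a + b) / 2)}"
    using countable_subset[OF _ countable_turning_level] uncountable_open_interval[of a b] assms by blast
  then obtain m' where m': "a < m'" "m' < b" "turning m' \<noteq> turning ((a + b) / 2)"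
    unfolding subset_iff greaterThanLessThan_iff mem_Collect_eq by blast
  have *: "\<exists>m. a < m \<and> m < b \<and> turning m / (2 * pi) \<in> \<rat>"
    if p: "a < p" "p < b" "a < q" "q < b" "turning p < turning q" for p q
  proof -
    have "turning p / (2 * pi) < turning q / (2 * pi)" using p by (simp add: divide_strict_right_mono)
    then obtain r where r: "r \<in> \<rat>" "turning p / (2 * pi) < r" "r < turning q / (2 * pi)" using Rats_dense_in_real by blast
    then have r': "turning p \<le> 2 * pi * r" "2 * pi * r \<le> turning q" by (auto simp: field_simps)
    have "connected (turning ` {a<..<b})" by (intro connected_continuous_image continuous_on_turning) auto
    then have "2 * pi * r \<in> turning ` {a<..<b}"
      using connectedD_interval[of "turning ` {a<..<b}" "turning p" "turning q" "2 * pi * r"] p r' by auto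
    then obtain m where "a < m" "m < b" "turning m = 2 * pi * r" by auto
    then show ?thesis using r(1) by (intro exI[of _ m]) auto
  qed
  have "(a + b) / 2 \<in> {a<..<b}" using assms by auto
  then show ?thesis using *[of m' "(a + b) / 2"] *[of "(a + b) / 2" m'] m' that
    by (metis greaterThanLessThan_iff linorder_neqE_linordered_idom)
qed

lemma dense_all_periodic: "{1 / 2<..} \<subseteq> closure {c. c > 1 / 2 \<and> all_periodic Plus c}"
proof
  fix c :: real assume "c \<in> {1 / 2<..}"
  then obtain m where m: "m > 0" "energy m = c" using ex_energy by auto
  show "c \<in> closure {c. c > 1 / 2 \<and> all_periodic Plus c}"
    unfolding closure_approachable
  proof (intro allI impI)
    fix e :: real assume "e > 0"
    \<comment> \<open>The second bound keeps the nearby energy above \<open>1/2\<close>.\<close>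
    then have "min e (c - 1 / 2) > 0" using \<open>c \<in> {1 / 2<..}\<close> by auto
    then obtain d where d: "d > 0" "\<And>m'. dist m' m < d \<Longrightarrow> dist (energy m') c < min e (c - 1 / 2)"
      using isCont_energy[OF m(1)] m(2) unfolding continuous_at_eps_delta by metis
    obtain m' where m': "m < m'" "m' < m + d" "turning m' / (2 * pi) \<in> \<rat>"
      using ex_rational_turning[of m "m + d"] d(1) by auto
    have "dist (energy m') c < min e (c - 1 / 2)" using m' by (intro d(2)) (auto simp: dist_real_def)
    moreover have "all_periodic Plus (energy m')" using m' m(1) all_periodic_level_iff[of m'] by auto
    ultimately show "\<exists>y \<in> {c. c > 1 / 2 \<and> all_periodic Plus c}. dist y c < e"
      by (intro bexI[of _ "energy m'"]) (auto simp: dist_real_def abs_if split: if_splits)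
  qed
qed

section \<open>The levels of infinite and of minimal energy\<close>

text \<open>\<open>(u, v)\<close> stays parallel to \<open>(cos x, sin x)\<close>, so the angle does
  not move.\<close>

lemma is_sol_Tinf:
  assumes "(x0, u0, v0) \<in> Tinf" shows "is_sol (\<lambda>t. (x0, u0 + t * cos x0, v0 + t * sin x0))"
proof -
  obtain r where "u0 = cos x0 * r" "v0 = sin x0 * r"
    using assms by (auto simp: Tinf_def Hinf_def rot_def)
  then show ?thesis unfolding is_sol_iff by (auto intro!: derivative_eq_intros simp: algebra_simps)
qed

lemma sol_Tinf:
  assumes "is_sol \<gamma>" "\<gamma> 0 = (x0, u0, v0)" "(x0, u0, v0) \<in> Tinf"
  shows "\<gamma> = (\<lambda>t. (x0, u0 + t * cos x0, v0 + t * sin x0))"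
  by (rule sol_unique[OF assms(1) is_sol_Tinf[OF assms(3)]]) (simp add: assms(2))

lemma Tinf_iff: "(x, u, v) \<in> Tinf \<longleftrightarrow> cos x * v - sin x * u = 0"
proof
  assume "(x, u, v) \<in> Tinf"
  then show "cos x * v - sin x * u = 0" by (auto simp: Tinf_def Hinf_def rot_def)
next
  assume "cos x * v - sin x * u = 0"
  then have "u = cos x * (cos x * u + sin x * v)" "v = sin x * (cos x * u + sin x * v)"
    using sin_cos_squared_add[of x] by algebra+
  then have "(x, u, v) = (x, rot x (cos x * u + sin x * v, 0))" by (simp add: rot_def)
  then show "(x, u, v) \<in> Tinf" unfolding Tinf_def Hinf_def by fastforce
qed

lemma invariant_Tinf: "invariant Tinf"
  unfolding invariant_def
proof (intro allI impI)
  fix \<gamma> t assume g: "is_sol \<gamma>" "\<gamma> 0 \<in> Tinf"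
  obtain x u v where 0: "\<gamma> 0 = (x, u, v)" by (cases "\<gamma> 0")
  have "\<gamma> t = (x, u + t * cos x, v + t * sin x)" using sol_Tinf[OF g(1) 0] g(2) 0 by simp
  moreover have "cos x * v - sin x * u = 0" using g(2) 0 Tinf_iff by simp
  ultimately show "\<gamma> t \<in> Tinf" by (simp add: Tinf_iff algebra_simps)
qed

section \<open>Covering by levels, the minimal level and global existence\<close>

lemma Hset_cover:
  fixes u v :: real
  assumes "v \<noteq> 0" obtains \<alpha> c where "c \<ge> 1 / 2" "(u, v) \<in> Hset \<alpha> c"
proof
  have "ln (v\<^sup>2) \<le> v\<^sup>2 - 1" using assms by (intro ln_le_minus_one) auto
  then show "(u\<^sup>2 + v\<^sup>2 - ln (v\<^sup>2)) / 2 \<ge> 1 / 2" using zero_le_power2[of u] by argo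
  show "(u, v) \<in> Hset (if v > 0 then Plus else Minus) ((u\<^sup>2 + v\<^sup>2 - ln (v\<^sup>2)) / 2)"
    using assms by (auto simp: H_def)
qed

lemma Tset_cover: "UNIV = (\<Union>c\<in>{1/2..}. \<Union>\<alpha>. Tset \<alpha> c) \<union> Tinf"
proof -
  have "p \<in> (\<Union>c\<in>{1/2..}. \<Union>\<alpha>. Tset \<alpha> c) \<union> Tinf" for p
  proof (cases p)
    case (fields x u v)
    show ?thesis
    proof (cases "cos x * v - sin x * u = 0")
      case True then show ?thesis by (simp add: fields Tinf_iff)
    next
      case False
      then obtain \<alpha> c where "c \<ge> 1 / 2" "(cos x * u + sin x * v, cos x * v - sin x * u) \<in> Hset \<alpha> c"
        by (rule Hset_cover)
      then show ?thesis by (auto simp: fields Tset_iff)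
    qed
  qed
  then show ?thesis by blast
qed

text \<open>Equality case of \<open>ln y \<le> y - 1\<close> at \<open>y = v\<^sup>2\<close>,
  together with \<open>u = 0\<close>.\<close>

lemma Hset_half: "Hset Plus (1 / 2) = {(0, 1)}"
proof -
  have "u = 0 \<and> v = 1" if "v > 0" "u\<^sup>2 + v\<^sup>2 - ln (v\<^sup>2) = 1" for u v :: real
  proof -
    have "ln (v\<^sup>2) \<le> v\<^sup>2 - 1" using that(1) by (intro ln_le_minus_one) auto
    then have u: "u\<^sup>2 = 0" "ln (v\<^sup>2) = v\<^sup>2 - 1" using that(2) zero_le_power2[of u] by linarith+
    have "v\<^sup>2 = 1" using that(1) u(2) by (intro ln_eq_minus_one) auto
    then show ?thesis using u(1) that(1) by (simp add: power2_eq_1_iff)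
  qed
  moreover have "u\<^sup>2 + v\<^sup>2 - ln (v\<^sup>2) = 1" if "H (u, v) = ereal (1 / 2)" "v > 0" for u v
    using that by (simp add: H_def)
  ultimately have "z = (0, 1)" if "H z = ereal (1 / 2)" "snd z > 0" for z
    using that by (metis prod.collapse)
  then show ?thesis by (auto simp: H_def)
qed

lemma Tset_half: "Tset Plus (1 / 2) = range (\<lambda>x. (x, - sin x, cos x))"
  unfolding Tset_def Hset_half by (auto simp: rot_def)

text \<open>The rotating-frame equilibrium \<open>(0, 1)\<close>, rotated back:
  \<open>X' = - v = - 1\<close>.\<close>

lemma is_sol_half: "is_sol (\<lambda>t. (x - t, - sin (x - t), cos (x - t)))"
proof -
  have "- (sin y * sin y) - cos y * cos y = - 1" for y :: real
    using sin_cos_squared_add[of y] by (simp add: power2_eq_square)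
  then show ?thesis unfolding is_sol_iff by (auto intro!: derivative_eq_intros)
qed

lemma sol_half:
  assumes "is_sol \<gamma>" "\<gamma> 0 \<in> Tset Plus (1 / 2)"
  obtains x where "\<gamma> = (\<lambda>t. (x - t, - sin (x - t), cos (x - t)))"
proof -
  obtain x where "\<gamma> 0 = (x, - sin x, cos x)" using assms(2) by (auto simp: Tset_half)
  then have "\<gamma> = (\<lambda>t. (x - t, - sin (x - t), cos (x - t)))"
    by (intro sol_unique[OF assms(1) is_sol_half]) simp
  then show ?thesis by (rule that)
qed

lemma level_half_Plus:
  assumes "is_sol \<gamma>" "\<gamma> 0 \<in> Tset Plus (1 / 2)"
  shows "orbit \<gamma> = Tset Plus (1 / 2)" "modeq (\<gamma> (t + 2 * pi)) (\<gamma> t)"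
    "0 < s \<Longrightarrow> s < 2 * pi \<Longrightarrow> \<not> modeq (\<gamma> s) (\<gamma> 0)"
proof -
  obtain x where g: "\<gamma> = (\<lambda>t. (x - t, - sin (x - t), cos (x - t)))" using sol_half[OF assms] .
  have sc: "sin a = sin b \<and> cos a = cos b" if "a - b = 2 * pi * of_int k" for a b and k :: int
    using sin_cos_eq_iff[of a b] that by (auto simp: algebra_simps)
  show "orbit \<gamma> = Tset Plus (1 / 2)"
  proof (intro set_eqI iffI)
    fix q assume "q \<in> orbit \<gamma>"
    then obtain t k where "x - t - fst q = 2 * pi * of_int (k::int)" "snd q = (- sin (x - t), cos (x - t))"
      by (auto simp: orbit_def modeq_def g)
    then have "q = (fst q, - sin (fst q), cos (fst q))" using sc[of "x - t" "fst q" k] by (simp add: prod_eq_iff)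
    then show "q \<in> Tset Plus (1 / 2)" unfolding Tset_half by (rule range_eqI)
  next
    fix q assume "q \<in> Tset Plus (1 / 2)"
    then obtain y where "q = (y, - sin y, cos y)" by (auto simp: Tset_half)
    then have "modeq (\<gamma> (x - y)) q" by (simp add: g modeq_def)
    then show "q \<in> orbit \<gamma>" unfolding orbit_def by blast
  qed
  show "modeq (\<gamma> (t + 2 * pi)) (\<gamma> t)"
    using sc[of "x - (t + 2 * pi)" "x - t" "- 1"] by (auto simp: g modeq_def intro!: exI[of _ "- 1"])
  assume s: "0 < s" "s < 2 * pi"
  show "\<not> modeq (\<gamma> s) (\<gamma> 0)"
  proof
    assume "modeq (\<gamma> s) (\<gamma> 0)"
    then obtain k :: int where "- s = 2 * pi * of_int k" by (auto simp: g modeq_def)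
    then have k: "s = 2 * pi * of_int (- k)" by simp
    then have "0 < 2 * pi * real_of_int (- k)" "2 * pi * real_of_int (- k) < 2 * pi * 1" using s by auto
    then have "0 < real_of_int (- k)" "real_of_int (- k) < 1"
      using mult_less_cancel_left_pos[of "2 * pi" 0 "real_of_int (- k)"]
        mult_less_cancel_left_pos[of "2 * pi" "real_of_int (- k)" 1] by simp_all
    then have "0 < - k" "- k < 1" by (simp_all only: of_int_0_less_iff of_int_less_1_iff)
    then show False by linarith
  qed
qed

lemma ex_sol_Plus:
  assumes "c \<ge> 1 / 2" "p \<in> Tset Plus c" shows "\<exists>\<gamma>. is_sol \<gamma> \<and> \<gamma> 0 = p"
proof (cases "c = 1 / 2")
  case True
  with assms(2) have "p \<in> Tset Plus (1 / 2)" by simp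
  then obtain x where "p = (x, - sin x, cos x)" unfolding Tset_half by blast
  then show ?thesis
    using is_sol_half[of x] by (intro exI[of _ "\<lambda>t. (x - t, - sin (x - t), cos (x - t))"]) simp
next
  case False
  then obtain m where m: "m > 0" "energy m = c" using ex_energy[of c] assms(1) by auto
  show ?thesis by (rule level_solutions[OF m(1)]) (use assms(2) m(2) in blast)
qed

text \<open>The cover reduces global existence to pieces on which solutions are explicit, up to
  reflection.\<close>

lemma ex_sol: "\<exists>\<gamma>. is_sol \<gamma> \<and> \<gamma> 0 = p"
proof -
  have "p \<in> (\<Union>c\<in>{1/2..}. \<Union>\<alpha>. Tset \<alpha> c) \<union> Tinf" unfolding Tset_cover[symmetric] by simp
  then consider "p \<in> Tinf" | c \<alpha> where "c \<ge> 1 / 2" "p \<in> Tset \<alpha> c"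
    unfolding Un_iff UN_iff atLeast_iff by blast
  then show ?thesis
  proof cases
    case 1
    obtain x u v where "p = (x, u, v)" by (cases p)
    with 1 show ?thesis
      using is_sol_Tinf[of x u v] by (intro exI[of _ "\<lambda>t. (x, u + t * cos x, v + t * sin x)"]) simp
  next
    case (2 c \<alpha>)
    show ?thesis
    proof (cases \<alpha>)
      case Plus then show ?thesis using ex_sol_Plus 2 by blast
    next
      case Minus
      then have "reflect p \<in> Tset Plus c" using 2 by simp
      then obtain \<gamma> where "is_sol \<gamma>" "\<gamma> 0 = reflect p" using ex_sol_Plus[OF 2(1)] by blast
      then have "is_sol (reflect \<circ> \<gamma>) \<and> (reflect \<circ> \<gamma>) 0 = p" by (simp add: is_sol_reflect)
      then show ?thesis by blast
    qed
  qed
qed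

lemma invariant_Tset:
  assumes "c \<ge> 1 / 2" shows "invariant (Tset \<alpha> c)"
proof -
  have Plus: "invariant (Tset Plus c)"
  proof (cases "c = 1 / 2")
    case True
    have "\<gamma> t \<in> Tset Plus (1 / 2)" if g: "is_sol \<gamma>" "\<gamma> 0 \<in> Tset Plus (1 / 2)" for \<gamma> t
    proof -
      obtain x where "\<gamma> = (\<lambda>t. (x - t, - sin (x - t), cos (x - t)))" using sol_half[OF g] .
      then show ?thesis unfolding Tset_half by blast
    qed
    then show ?thesis unfolding True invariant_def by blast
  next
    case False
    then obtain m where "m > 0" "energy m = c" using ex_energy[of c] assms by auto
    then show ?thesis using invariant_level by blast
  qed
  show ?thesis
  proof (cases \<alpha>)
    case Minus
    have "\<gamma> t \<in> Tset Minus c" if "is_sol \<gamma>" "\<gamma> 0 \<in> Tset Minus c" for \<gamma> t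
    proof -
      have "is_sol (reflect \<circ> \<gamma>)" "(reflect \<circ> \<gamma>) 0 \<in> Tset Plus c" using that is_sol_reflect by auto
      then have "(reflect \<circ> \<gamma>) t \<in> Tset Plus c" using Plus unfolding invariant_def by blast
      then show ?thesis by simp
    qed
    then show ?thesis using Minus by (simp add: invariant_def)
  qed (use Plus in simp)
qed

lemma level_half:
  assumes g: "is_sol \<gamma>" "\<gamma> 0 \<in> Tset \<alpha> (1 / 2)"
  shows "orbit \<gamma> = Tset \<alpha> (1 / 2)
    \<and> (\<forall>t. modeq (\<gamma> (t + 2 * pi)) (\<gamma> t))
    \<and> (\<forall>s. 0 < s \<and> s < 2 * pi \<longrightarrow> \<not> modeq (\<gamma> s) (\<gamma> 0))"
proof (cases \<alpha>)
  case Plus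
  then show ?thesis using level_half_Plus[OF g(1)] g(2) by blast
next
  case Minus
  then have g': "is_sol (reflect \<circ> \<gamma>)" "(reflect \<circ> \<gamma>) 0 \<in> Tset Plus (1 / 2)"
    using g is_sol_reflect by auto
  have "reflect ` orbit (reflect \<circ> \<gamma>) = orbit \<gamma>" by (simp add: orbit_reflect image_image)
  then have "orbit \<gamma> = Tset (flip Plus) (1 / 2)"
    unfolding level_half_Plus(1)[OF g'] Tset_eq_reflect ..
  then show ?thesis using level_half_Plus(2,3)[OF g'] Minus by simp
qed

lemma Tset_half_nonempty: "Tset \<alpha> (1 / 2) \<noteq> {}"
  using Tset_eq_reflect[of Plus "1 / 2"] by (cases \<alpha>) (auto simp: Tset_half)

lemma periodic_or_dense:
  assumes "c > 1 / 2" shows "all_periodic \<alpha> c \<or> all_dense \<alpha> c"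
proof -
  obtain m where m: "m > 0" "energy m = c" using ex_energy[OF assms] by blast
  have "all_periodic Plus c \<or> all_dense Plus c"
    using all_periodic_if_rational[OF m(1)] all_dense_if_irrational[OF m(1)] m(2) by blast
  then show ?thesis using all_periodic_iff[of \<alpha> c] all_dense_flip[of Plus c] by (cases \<alpha>) auto
qed

theorem theorem1p3:
  shows "(\<forall>p. \<exists>\<gamma>. is_sol \<gamma> \<and> \<gamma> 0 = p)
    \<and> UNIV = (\<Union>c\<in>{1/2..}. \<Union>\<alpha>. Tset \<alpha> c) \<union> Tinf
    \<and> (\<forall>\<alpha> c. c \<ge> 1/2 \<longrightarrow> invariant (Tset \<alpha> c))
    \<and> invariant Tinf
    \<and> (\<forall>\<alpha>. Tset \<alpha> (1/2) \<noteq> {} \<and>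
         (\<forall>\<gamma>. is_sol \<gamma> \<longrightarrow> \<gamma> 0 \<in> Tset \<alpha> (1/2) \<longrightarrow>
            orbit \<gamma> = Tset \<alpha> (1/2)
            \<and> (\<forall>t. modeq (\<gamma> (t + 2 * pi)) (\<gamma> t))
            \<and> (\<forall>s. 0 < s \<and> s < 2 * pi \<longrightarrow> \<not> modeq (\<gamma> s) (\<gamma> 0))))
    \<and> (\<forall>\<alpha> c. c > 1/2 \<longrightarrow> all_periodic \<alpha> c \<or> all_dense \<alpha> c)
    \<and> (\<forall>\<alpha>. countable {c. c > 1/2 \<and> all_periodic \<alpha> c}
         \<and> {1/2<..} \<subseteq> closure {c. c > 1/2 \<and> all_periodic \<alpha> c})
    \<and> (\<forall>\<gamma> x0 u0 v0. is_sol \<gamma> \<longrightarrow> \<gamma> 0 = (x0, u0, v0) \<longrightarrow> (x0, u0, v0) \<in> Tinf \<longrightarrow>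
         (\<forall>t. \<gamma> t = (x0, u0 + t * cos x0, v0 + t * sin x0)))"
proof (intro conjI allI)
  fix \<alpha>
  have eq: "{c. c > 1/2 \<and> all_periodic \<alpha> c} = {c. c > 1/2 \<and> all_periodic Plus c}"
    using all_periodic_iff by blast
  show "countable {c. c > 1/2 \<and> all_periodic \<alpha> c}"
    "{1/2<..} \<subseteq> closure {c. c > 1/2 \<and> all_periodic \<alpha> c}"
    unfolding eq by (rule countable_all_periodic dense_all_periodic)+
next
  fix \<alpha> \<gamma>
  show "is_sol \<gamma> \<longrightarrow> \<gamma> 0 \<in> Tset \<alpha> (1/2) \<longrightarrow>
            orbit \<gamma> = Tset \<alpha> (1/2)
            \<and> (\<forall>t. modeq (\<gamma> (t + 2 * pi)) (\<gamma> t))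
            \<and> (\<forall>s. 0 < s \<and> s < 2 * pi \<longrightarrow> \<not> modeq (\<gamma> s) (\<gamma> 0))"
    using level_half by blast
next
  fix \<alpha> c
  show "c > 1/2 \<longrightarrow> all_periodic \<alpha> c \<or> all_dense \<alpha> c" using periodic_or_dense by blast
qed (use ex_sol Tset_cover invariant_Tset invariant_Tinf Tset_half_nonempty sol_Tinf
    in \<open>auto simp only: fun_eq_iff\<close>)

end
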